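(* Let $h\ge 3$ and $n\ge 3$ be integers, let $O_n$ and $M_n$ be the ortho-chain and the meta-chain of length $n$ all of whose cycles have $h$ vertices, and let $A_n$ be a chain $h$-cactus of length $n$ that is isomorphic neither to $O_n$ nor to $M_n$. Then $$\Psi(O_n)<\Psi(A_n)<\Psi(M_n).$$
   Context: All graphs are finite and simple. $\Psi(G)$ denotes the total number of independent sets of $G$ (including the empty set). A cactus is a connected graph in which each edge lies in at most one cycle. A chain cactus is a cactus in which each block is a cycle containing at most two cut vertices and each cut vertex is contained in exactly two cycles; its length is the number of its cycles. A chain $h$-cactus is a chain cactus all of whose cycles have exactly $h$ vertices. In a chain cactus of length $n$ the cycles are denoted $C^{(1)},\dots,C^{(n)}$ in their order along the chain (consecutive cycles share one cut vertex). Internal cycles are $C^{(2)},\dots,C^{(n-1)}$; each contains exactly two cut vertices. An internal cycle is in $k$-position if its two cut vertices are at distance $k$ (in the cycle); $1$-position is called ortho-position and $2$-position is called meta-position. The ortho-chain $O_n$ (respectively meta-chain $M_n$) is the chain $h$-cactus of length $n$ all of whose internal cycles are in ortho-position (respectively meta-position); each is unique up to isomorphism when it exists. (For $h=3$ and $n\ge 3$ every chain $h$-cactus of length $n$ is an ortho-chain and no meta-chain exists, so the statement is vacuous.) *)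

theory Defs
  imports Graph_Theory.Graph_Theory
begin

text \<open>
  A finite simple graph is a digraph in the locale \<^locale>\<open>graph\<close>: finite, loop-free, symmetric and
  without parallel arcs. An undirected edge is a pair of opposite arcs, so undirected subgraphs
  have to be required to be symmetric (or to be in the locale \<^locale>\<open>graph\<close>) explicitly.
\<close>

definition independent_set :: "('a,'b) pre_digraph \<Rightarrow> 'a set \<Rightarrow> bool" where
  "independent_set G S \<longleftrightarrow> S \<subseteq> verts G \<and> (\<forall>u\<in>S. \<forall>v\<in>S. \<not> u \<rightarrow>\<^bsub>G\<^esub> v)"

definition num_independent_sets :: "('a,'b) pre_digraph \<Rightarrow> nat" (\<open>\<Psi>\<close>) where
  "\<Psi> G = card {S. independent_set G S}"

text \<open>
  The closed arc walk \<^term>\<open>p\<close> traverses each edge of the cycle in one direction only. The length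
  bound is needed because a single edge traversed back and forth is a
  \<^const>\<open>pre_digraph.cycle\<close> of length 2.
\<close>
definition cycle_graph :: "('a,'b) pre_digraph \<Rightarrow> bool" where
  "cycle_graph C \<longleftrightarrow> graph C \<and>
     (\<exists>p. pre_digraph.cycle C p \<and> length p \<ge> 3 \<and>
          verts C = tail C ` set p \<and>
          arcs_ends C = arc_to_ends C ` set p \<union> (arc_to_ends C ` set p)\<inverse>)"

definition cycles_of :: "('a,'b) pre_digraph \<Rightarrow> ('a,'b) pre_digraph set" where
  "cycles_of G = {C. subgraph C G \<and> cycle_graph C}"

text \<open>Deleting a cut vertex separates two vertices that lie in the same component.\<close>
definition cut_vertex :: "('a,'b) pre_digraph \<Rightarrow> 'a \<Rightarrow> bool" where
  "cut_vertex G v \<longleftrightarrow> v \<in> verts G \<and>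
     (\<exists>u\<in>verts G - {v}. \<exists>w\<in>verts G - {v}.
        u \<rightarrow>\<^sup>*\<^bsub>G\<^esub> w \<and> \<not> u \<rightarrow>\<^sup>*\<^bsub>pre_digraph.del_vert G v\<^esub> w)"

text \<open>Maximal connected subgraphs without a cut vertex of their own.\<close>
definition block :: "('a,'b) pre_digraph \<Rightarrow> ('a,'b) pre_digraph \<Rightarrow> bool" where
  "block G B \<longleftrightarrow>
     pre_digraph.max_subgraph G (\<lambda>H. symmetric H \<and> connected H \<and> (\<nexists>v. cut_vertex H v)) B"

definition cactus :: "('a,'b) pre_digraph \<Rightarrow> bool" where
  "cactus G \<longleftrightarrow> graph G \<and> connected G \<and>
     (\<forall>e\<in>arcs G. \<forall>C\<in>cycles_of G. \<forall>D\<in>cycles_of G. e \<in> arcs C \<and> e \<in> arcs D \<longrightarrow> C = D)"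

definition chain_cactus :: "('a,'b) pre_digraph \<Rightarrow> bool" where
  "chain_cactus G \<longleftrightarrow> cactus G \<and>
     (\<forall>B. block G B \<longrightarrow> cycle_graph B \<and> card {v \<in> verts B. cut_vertex G v} \<le> 2) \<and>
     (\<forall>v. cut_vertex G v \<longrightarrow> card {C \<in> cycles_of G. v \<in> verts C} = 2)"

definition chain_h_cactus :: "nat \<Rightarrow> nat \<Rightarrow> ('a,'b) pre_digraph \<Rightarrow> bool" where
  "chain_h_cactus h n G \<longleftrightarrow> chain_cactus G \<and> card (cycles_of G) = n \<and>
     (\<forall>C\<in>cycles_of G. card (verts C) = h)"

definition chain_order :: "('a,'b) pre_digraph \<Rightarrow> ('a,'b) pre_digraph list \<Rightarrow> bool" where
  "chain_order G Cs \<longleftrightarrow> distinct Cs \<and> set Cs = cycles_of G \<and>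
     (\<forall>i. Suc i < length Cs \<longrightarrow>
        (\<exists>v. cut_vertex G v \<and> verts (Cs ! i) \<inter> verts (Cs ! Suc i) = {v}))"

text \<open>
  The chain order is unique up to reversal, so an internal cycle does not depend on the choice
  of \<^term>\<open>Cs\<close>.
\<close>
definition internal_cycle :: "('a,'b) pre_digraph \<Rightarrow> ('a,'b) pre_digraph \<Rightarrow> bool" where
  "internal_cycle G C \<longleftrightarrow>
     (\<exists>Cs i. chain_order G Cs \<and> 0 < i \<and> Suc i < length Cs \<and> C = Cs ! i)"

text \<open>With unit arc weights, \<^const>\<open>wf_digraph.\<mu>\<close> is the usual graph distance.\<close>
definition in_position :: "('a,'b) pre_digraph \<Rightarrow> ('a,'b) pre_digraph \<Rightarrow> nat \<Rightarrow> bool" where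
  "in_position G C k \<longleftrightarrow>
     (\<exists>u v. u \<noteq> v \<and> {w \<in> verts C. cut_vertex G w} = {u, v} \<and>
            wf_digraph.\<mu> C (\<lambda>_. 1) u v = ereal (real k))"

definition ortho_chain :: "nat \<Rightarrow> nat \<Rightarrow> ('a,'b) pre_digraph \<Rightarrow> bool" where
  "ortho_chain h n G \<longleftrightarrow> chain_h_cactus h n G \<and> (\<forall>C. internal_cycle G C \<longrightarrow> in_position G C 1)"

definition meta_chain :: "nat \<Rightarrow> nat \<Rightarrow> ('a,'b) pre_digraph \<Rightarrow> bool" where
  "meta_chain h n G \<longleftrightarrow> chain_h_cactus h n G \<and> (\<forall>C. internal_cycle G C \<longrightarrow> in_position G C 2)"

end

theory Submission
  imports Defs "HOL-Number_Theory.Fib" "HOL-Number_Theory.Cong"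
begin

text \<open>
  Number the cycles along the chain and let \<open>d\<close> be the distance of the two cut vertices of an
  internal cycle. If \<open>x\<close> independent sets of the first \<open>i\<close> cycles avoid the next cut vertex and \<open>y\<close>
  contain it, then attaching a further cycle is the linear map
  \<open>x' = x (F\<^bsub>h+1\<^esub> - p) + y p\<close>, \<open>y' = x p + y (F\<^bsub>h-1\<^esub> - p)\<close> with Fibonacci numbers \<open>F\<close> and
  \<open>p = F\<^bsub>d\<^esub> F\<^bsub>h-d\<^esub>\<close>. The sum \<open>x' + y'\<close> does not depend on \<open>d\<close>, and since \<open>x > y\<close> the
  entry \<open>x'\<close> strictly decreases in \<open>p\<close>; so the total count strictly decreases in each of the \<open>p\<close>'s. Among
  \<open>1 \<le> d \<le> h/2\<close> the value of \<open>p\<close> is largest only at \<open>d = 1\<close> and smallest only at \<open>d = 2\<close>.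

  That the cycles of an abstract chain cactus are arranged in this way rests on one fact: cycles
  that are blocks cannot be linked cyclically through distinct vertices, because their union would be a
  larger connected subgraph without a cut vertex.
\<close>

section \<open>Counting independent sets of a chain of cycles\<close>

text \<open>A larger \<open>p\<close> lowers \<open>x'\<close> but raises \<open>y'\<close> by the
  same amount, so the pair of counts is not monotone, and carrying the effect through the remaining
  cycles needs another order. The pair of \<open>x\<close> and \<open>s = x + y\<close> supplies it:
  \<open>s' = s F(h-1) + x F(h)\<close> and \<open>x' = x F(h+1) - p (2 x - s)\<close> are both
  nondecreasing in \<open>x\<close> and \<open>s\<close>, because \<open>F(h+1) >= 2 p\<close>. The
  effect is absent at the two ends: before the first cycle \<open>x = y\<close>, and after the last
  one only the sum is read. The distance chosen in an end cycle is therefore a free convention,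
  fixed as 1, and two chains with the same internal distances get the same values of
  \<open>d\<close>. This turns the failure of isomorphism into an internal cycle where the distances
  differ. In the structural part the linking vertices have to be distinct, but the cycles may
  repeat. This allows the fact about cyclic links to be applied to cycles picked edge by edge along
  an arbitrary path.\<close>

definition indep_count :: "('a \<times> 'a) set \<Rightarrow> 'a set \<Rightarrow> ('a set \<Rightarrow> bool) \<Rightarrow> nat" where
  "indep_count E V P = card {S. S \<subseteq> V \<and> (\<forall>(u, v) \<in> E. u \<notin> S \<or> v \<notin> S) \<and> P S}"

lemma indep_count_split:
  assumes "finite V"
  shows "indep_count E V P = indep_count E V (\<lambda>S. P S \<and> Q S) + indep_count E V (\<lambda>S. P S \<and> \<not> Q S)"
proof -
  have "{S. S \<subseteq> V \<and> (\<forall>(u, v) \<in> E. u \<notin> S \<or> v \<notin> S) \<and> P S}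
     = {S. S \<subseteq> V \<and> (\<forall>(u, v) \<in> E. u \<notin> S \<or> v \<notin> S) \<and> P S \<and> Q S} \<union>
       {S. S \<subseteq> V \<and> (\<forall>(u, v) \<in> E. u \<notin> S \<or> v \<notin> S) \<and> P S \<and> \<not> Q S}" by auto
  then show ?thesis unfolding indep_count_def using assms
    by (simp, subst card_Un_disjoint) (auto intro: finite_subset[of _ "Pow V"])
qed

text \<open>Restriction to \<open>A\<close> and \<open>B\<close> is inverse to union: no edge joins
  \<open>A - B\<close> to \<open>B - A\<close>, and \<open>P\<close> and \<open>Q\<close> prescribe
  the same membership on the overlap, so two parts never disagree there. Counts multiply once the
  state of the overlap is fixed.\<close>

lemma indep_count_glue:
  assumes EA: "EA \<subseteq> A \<times> A" and EB: "EB \<subseteq> B \<times> B"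
    and agree: "\<And>X Y x. X \<subseteq> A \<Longrightarrow> Y \<subseteq> B \<Longrightarrow> P X \<Longrightarrow> Q Y \<Longrightarrow>
      x \<in> A \<Longrightarrow> x \<in> B \<Longrightarrow> x \<in> X \<longleftrightarrow> x \<in> Y"
    and R: "\<And>S. S \<subseteq> A \<union> B \<Longrightarrow> R S \<longleftrightarrow> P (S \<inter> A) \<and> Q (S \<inter> B)"
  shows "indep_count (EA \<union> EB) (A \<union> B) R = indep_count EA A P * indep_count EB B Q"
proof -
  let ?I = "\<lambda>E V P. {S. S \<subseteq> V \<and> (\<forall>(u, v) \<in> E. u \<notin> S \<or> v \<notin> S) \<and> P S}"
  have "bij_betw (\<lambda>S. (S \<inter> A, S \<inter> B)) (?I (EA \<union> EB) (A \<union> B) R) (?I EA A P \<times> ?I EB B Q)"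
  proof (rule bij_betw_byWitness[where f' = "\<lambda>(X, Y). X \<union> Y"], goal_cases)
    case 1
    show ?case by auto
  next
    case 2
    have "(X \<union> Y) \<inter> A = X" "(X \<union> Y) \<inter> B = Y"
      if "X \<in> ?I EA A P" "Y \<in> ?I EB B Q" for X Y
      using agree[of X Y] that by auto
    then show ?case by auto
  next
    case 3
    show ?case using R by fastforce
  next
    case 4
    have "X \<union> Y \<in> ?I (EA \<union> EB) (A \<union> B) R"
      if X: "X \<in> ?I EA A P" and Y: "Y \<in> ?I EB B Q" for X Y
    proof -
      have e: "(X \<union> Y) \<inter> A = X" "(X \<union> Y) \<inter> B = Y"
        using agree[of X Y] X Y by auto
      have "R (X \<union> Y)" using R[of "X \<union> Y"] X Y unfolding e by blast
      moreover have "u \<notin> X \<union> Y \<or> v \<notin> X \<union> Y" if "(u, v) \<in> EA \<union> EB" for u v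
        using that
      proof
        assume uv: "(u, v) \<in> EA"
        then have "u \<in> A" "v \<in> A" using EA by auto
        with e(1) have "u \<in> X \<union> Y \<longleftrightarrow> u \<in> X" "v \<in> X \<union> Y \<longleftrightarrow> v \<in> X" by blast+
        with X uv show ?thesis by auto
      next
        assume uv: "(u, v) \<in> EB"
        then have "u \<in> B" "v \<in> B" using EB by auto
        with e(2) have "u \<in> X \<union> Y \<longleftrightarrow> u \<in> Y" "v \<in> X \<union> Y \<longleftrightarrow> v \<in> Y" by blast+
        with Y uv show ?thesis by auto
      qed
      moreover have "X \<union> Y \<subseteq> A \<union> B" using X Y by blast
      ultimately show ?thesis by blast
    qed
    note glued = this
    show ?case
    proof
      fix S assume "S \<in> (\<lambda>(X, Y). X \<union> Y) ` (?I EA A P \<times> ?I EB B Q)"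
      then obtain X Y where "S = X \<union> Y" "X \<in> ?I EA A P" "Y \<in> ?I EB B Q"
        by (elim imageE SigmaE) (simp only: prod.case)
      then show "S \<in> ?I (EA \<union> EB) (A \<union> B) R" using glued by (simp only:)
    qed
  qed
  from bij_betw_same_card[OF this] show ?thesis
    by (simp add: indep_count_def card_cartesian_product)
qed

section \<open>Paths, and cycles as two glued paths\<close>

definition path_edges :: "(nat \<Rightarrow> 'a) \<Rightarrow> nat \<Rightarrow> ('a \<times> 'a) set" where
  "path_edges f m = {(f j, f (Suc j)) | j. j < m}"

lemma path_edges_subset: "path_edges f m \<subseteq> f ` {..m} \<times> f ` {..m}"
  by (auto simp: path_edges_def)

lemma path_edges_add: "path_edges f (k + l) = path_edges f k \<union> path_edges (\<lambda>j. f (k + j)) l"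
proof -
  have "(f j, f (Suc j)) \<in> path_edges f k \<union> path_edges (\<lambda>j. f (k + j)) l" if "j < k + l" for j
  proof (cases "j < k")
    case False
    with that have "j - k < l" "j = k + (j - k)" by auto
    then show ?thesis by (auto simp: path_edges_def intro!: exI[of _ "j - k"])
  qed (auto simp: path_edges_def)
  then show ?thesis by (auto simp: path_edges_def)
qed

lemma path_edges_one: "path_edges f (Suc 0) = {(f 0, f (Suc 0))}"
  by (auto simp: path_edges_def)

lemma indep_count_path_one:
  assumes "f 0 \<noteq> f (Suc 0)"
  shows "indep_count (path_edges f (Suc 0)) (f ` {..Suc 0}) (\<lambda>S. (f 0 \<in> S) = a \<and> (f (Suc 0) \<in> S) = b)
     = fib (2 - of_bool a - of_bool b)"
proof -
  have "f ` {..Suc 0} = {f 0, f (Suc 0)}" by (auto simp: atMost_Suc)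
  moreover have "{S. S \<subseteq> {f 0, f (Suc 0)} \<and> (f 0 \<notin> S \<or> f (Suc 0) \<notin> S) \<and> (f 0 \<in> S) = a \<and> (f (Suc 0) \<in> S) = b}
    = (if a \<and> b then {} else {(if a then {f 0} else {}) \<union> (if b then {f (Suc 0)} else {})})"
    using assms by auto
  ultimately show ?thesis
    by (cases a; cases b) (simp_all add: indep_count_def path_edges_one numeral_2_eq_2)
qed

text \<open>Splitting on the vertex before the last gives the Fibonacci recurrence. Each chosen end
  forbids its neighbour, which lowers the index by one; \<open>fib 0 = 0\<close> covers a single
  edge with both ends chosen. The length is \<open>Suc m\<close> since the ends of a path without
  edges coincide.\<close>

lemma indep_count_path_Suc:
  assumes "inj_on f {..Suc m}"
  shows "indep_count (path_edges f (Suc m)) (f ` {..Suc m}) (\<lambda>S. (f 0 \<in> S) = a \<and> (f (Suc m) \<in> S) = b)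
     = fib (m + 2 - of_bool a - of_bool b)"
  using assms
proof (induction m arbitrary: b)
  case 0
  then have "f 0 \<noteq> f (Suc 0)" by (auto simp: inj_on_def)
  then show ?case using indep_count_path_one[of f a b] by simp
next
  case (Suc m)
  let ?g = "\<lambda>j. f (Suc m + j)"
  let ?A = "f ` {..Suc m}" and ?B = "?g ` {..Suc 0}"
  have inj: "inj_on f {..Suc m}" using Suc.prems by (rule inj_on_subset) auto
  have AB: "?A \<union> ?B = f ` {..Suc (Suc m)}" by (auto simp: atMost_Suc)
  have new: "f (Suc (Suc m)) \<notin> ?A" using inj_on_image_mem_iff[OF Suc.prems, of "Suc (Suc m)" "{..Suc m}"] by simp
  have E: "path_edges f (Suc (Suc m)) = path_edges f (Suc m) \<union> path_edges ?g (Suc 0)"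
    using path_edges_add[of f "Suc m" "Suc 0"] by simp
  have B: "?B = {f (Suc m), f (Suc (Suc m))}" by (auto simp: atMost_Suc)
  have step: "indep_count (path_edges f (Suc (Suc m))) (f ` {..Suc (Suc m)})
      (\<lambda>S. ((f 0 \<in> S) = a \<and> (f (Suc (Suc m)) \<in> S) = b) \<and> (f (Suc m) \<in> S) = c)
    = fib (m + 2 - of_bool a - of_bool c) * fib (2 - of_bool c - of_bool b)" for c
    unfolding E AB[symmetric] Suc.IH[OF inj, of c, symmetric]
  proof -
    have g: "?g 0 \<noteq> ?g (Suc 0)" using new by (metis add_0_right add_Suc_right atMost_iff imageI order_refl)
    show "indep_count (path_edges f (Suc m) \<union> path_edges ?g (Suc 0)) (?A \<union> ?B)
        (\<lambda>S. ((f 0 \<in> S) = a \<and> (f (Suc (Suc m)) \<in> S) = b) \<and> (f (Suc m) \<in> S) = c)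
      = indep_count (path_edges f (Suc m)) ?A (\<lambda>S. (f 0 \<in> S) = a \<and> (f (Suc m) \<in> S) = c) *
        fib (2 - of_bool c - of_bool b)"
      unfolding indep_count_path_one[of ?g c b, OF g, symmetric]
    proof (rule indep_count_glue)
      show "path_edges f (Suc m) \<subseteq> ?A \<times> ?A" "path_edges ?g (Suc 0) \<subseteq> ?B \<times> ?B"
        by (rule path_edges_subset)+
      show "x \<in> X \<longleftrightarrow> x \<in> Y" if "(f 0 \<in> X) = a \<and> (f (Suc m) \<in> X) = c"
          "(?g 0 \<in> Y) = c \<and> (?g (Suc 0) \<in> Y) = b" "x \<in> ?A" "x \<in> ?B" for X Y x
      proof -
        have "x \<noteq> f (Suc (Suc m))" using that(3) new by metis
        moreover have "x \<in> {f (Suc m), f (Suc (Suc m))}" using that(4) unfolding B .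
        ultimately have "x = f (Suc m)" by simp
        then show ?thesis using that(1,2) by simp
      qed
      show "((f 0 \<in> S) = a \<and> (f (Suc (Suc m)) \<in> S) = b) \<and> (f (Suc m) \<in> S) = c \<longleftrightarrow>
         ((f 0 \<in> S \<inter> ?A) = a \<and> (f (Suc m) \<in> S \<inter> ?A) = c) \<and>
         ((?g 0 \<in> S \<inter> ?B) = c \<and> (?g (Suc 0) \<in> S \<inter> ?B) = b)" for S
        using new unfolding B by auto
    qed
  qed
  have "indep_count (path_edges f (Suc (Suc m))) (f ` {..Suc (Suc m)})
      (\<lambda>S. (f 0 \<in> S) = a \<and> (f (Suc (Suc m)) \<in> S) = b) =
     fib (m + 2 - of_bool a - of_bool True) * fib (2 - of_bool True - of_bool b) +
     fib (m + 2 - of_bool a - of_bool False) * fib (2 - of_bool False - of_bool b)"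
    unfolding step[symmetric] by (subst indep_count_split[where Q = "\<lambda>S. f (Suc m) \<in> S"]) auto
  then show ?case by (cases a; cases b; cases m) (simp_all add: numeral_2_eq_2)
qed

lemma indep_count_path:
  assumes "inj_on f {..m}" "0 < m"
  shows "indep_count (path_edges f m) (f ` {..m}) (\<lambda>S. (f 0 \<in> S) = a \<and> (f m \<in> S) = b)
     = fib (m + 1 - of_bool a - of_bool b)"
  using assms indep_count_path_Suc[of f "m - 1" a b] by simp

text \<open>Vertices \<open>0\<close> and \<open>k\<close> cut the cycle into arcs with
  \<open>k\<close> and \<open>h - k\<close> edges that meet only in these two vertices, so fixing
  their state makes the count a product. The second arc runs from \<open>f k\<close> to
  \<open>f h = f 0\<close>, which exchanges the roles of \<open>a\<close> and
  \<open>b\<close>.\<close>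

lemma indep_count_cycle:
  assumes inj: "inj_on f {..<h}" and closed: "f h = f 0" and k: "0 < k" "k < h"
  shows "indep_count (path_edges f h) (f ` {..<h}) (\<lambda>S. (f 0 \<in> S) = a \<and> (f k \<in> S) = b)
     = fib (k + 1 - of_bool a - of_bool b) * fib (h - k + 1 - of_bool a - of_bool b)"
proof -
  let ?g = "\<lambda>j. f (k + j)"
  let ?A = "f ` {..k}" and ?B = "?g ` {..h - k}"
  have h: "k + (h - k) = h" using k by simp
  have E: "path_edges f h = path_edges f k \<union> path_edges ?g (h - k)"
    using path_edges_add[of f k "h - k"] h by simp
  have V: "f ` {..<h} = ?A \<union> ?B"
  proof (intro equalityI subsetI)
    fix x assume "x \<in> f ` {..<h}"
    then obtain j where j: "j < h" "x = f j" by auto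
    show "x \<in> ?A \<union> ?B"
    proof (cases "j \<le> k")
      case False
      then have "x = ?g (j - k)" "j - k \<le> h - k" using j by auto
      then show ?thesis by blast
    qed (use j in auto)
  next
    fix x assume "x \<in> ?A \<union> ?B"
    then have "\<exists>j\<le>h. x = f j"
    proof
      assume "x \<in> ?B"
      then obtain i where "i \<le> h - k" "x = f (k + i)" by blast
      then show ?thesis using k by (intro exI[of _ "k + i"]) auto
    next
      assume "x \<in> ?A"
      then obtain i where "i \<le> k" "x = f i" by blast
      then show ?thesis using k by (intro exI[of _ i]) auto
    qed
    then obtain j where "j \<le> h" "x = f j" by blast
    then show "x \<in> f ` {..<h}" using closed k by (cases "j = h") auto
  qed
  have injA: "inj_on f {..k}" using inj by (rule inj_on_subset) (use k in auto)
  have injB: "inj_on ?g {..h - k}"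
  proof (rule inj_onI)
    fix i j assume *: "i \<in> {..h - k}" "j \<in> {..h - k}" "f (k + i) = f (k + j)"
    have neq: "f (k + i) \<noteq> f 0" if "i < h - k" for i
    proof -
      have "k + i < h" using that h by linarith
      then show ?thesis using inj_onD[OF inj, of "k + i" 0] k by auto
    qed
    consider "i < h - k" "j < h - k" | "i = h - k" "j < h - k" | "j = h - k" "i < h - k" | "i = j"
      using * by fastforce
    then show "i = j"
    proof cases
      case 1
      then have "k + i < h" "k + j < h" using h by linarith+
      then show ?thesis using inj_onD[OF inj *(3)] by simp
    qed (use * closed neq[of i] neq[of j] h in auto)
  qed
  have int: "x = f 0 \<or> x = f k" if x: "x \<in> ?A" "x \<in> ?B" for x
  proof -
    obtain i where i: "i \<le> k" "x = f i" using x(1) by blast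
    obtain j where j: "j \<le> h - k" "x = f (k + j)" using x(2) by blast
    note ij = i j
    show ?thesis
    proof (cases "k + j = h")
      case True then show ?thesis using ij closed by simp
    next
      case False
      then have "i = k + j" using ij inj k by (auto simp: inj_on_def)
      then show ?thesis using ij by auto
    qed
  qed
  have in_AB: "f 0 \<in> ?A" "f k \<in> ?A" "f 0 \<in> ?B" "f k \<in> ?B"
    using closed h by (auto intro: rev_image_eqI[of "h - k"] rev_image_eqI[of 0])
  have "indep_count (path_edges f k \<union> path_edges ?g (h - k)) (?A \<union> ?B) (\<lambda>S. (f 0 \<in> S) = a \<and> (f k \<in> S) = b)
    = indep_count (path_edges f k) ?A (\<lambda>S. (f 0 \<in> S) = a \<and> (f k \<in> S) = b) *
      indep_count (path_edges ?g (h - k)) ?B (\<lambda>S. (?g 0 \<in> S) = b \<and> (?g (h - k) \<in> S) = a)"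
  proof (rule indep_count_glue)
    show "path_edges f k \<subseteq> ?A \<times> ?A" "path_edges ?g (h - k) \<subseteq> ?B \<times> ?B"
      by (rule path_edges_subset)+
    show "x \<in> X \<longleftrightarrow> x \<in> Y"
      if "(f 0 \<in> X) = a \<and> (f k \<in> X) = b" "(?g 0 \<in> Y) = b \<and> (?g (h - k) \<in> Y) = a"
        "x \<in> ?A" "x \<in> ?B" for X Y x
      using int[OF that(3,4)] that(1,2) closed h by auto
    show "(f 0 \<in> S) = a \<and> (f k \<in> S) = b \<longleftrightarrow>
       ((f 0 \<in> S \<inter> ?A) = a \<and> (f k \<in> S \<inter> ?A) = b) \<and>
       ((?g 0 \<in> S \<inter> ?B) = b \<and> (?g (h - k) \<in> S \<inter> ?B) = a)" for S
      using in_AB closed h by auto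
  qed
  also have "\<dots> = fib (k + 1 - of_bool a - of_bool b) * fib (h - k + 1 - of_bool b - of_bool a)"
    using indep_count_path[OF injA k(1), of a b] indep_count_path[OF injB, of b a] k(2) by simp
  finally show ?thesis unfolding E V by (simp add: add.commute diff_commute)
qed

text \<open>
  \<open>F i j\<close> is vertex number \<open>j mod h\<close> of the \<open>i\<close>-th cycle (counted from \<open>0\<close>), starting at the vertex shared
  with the previous cycle; the vertex shared with the next cycle has number \<open>d i\<close>.
\<close>
definition chain_coords ::
  "nat \<Rightarrow> nat \<Rightarrow> (nat \<Rightarrow> nat) \<Rightarrow> (nat \<Rightarrow> nat \<Rightarrow> 'a) \<Rightarrow> ('a, 'b) pre_digraph \<Rightarrow> bool" where
  "chain_coords h n d F G \<longleftrightarrow>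
     (\<forall>i<n. 0 < d i \<and> d i < h) \<and>
     verts G = {F i j | i j. i < n} \<and>
     arcs_ends G = {(F i j, F i (Suc j)) | i j. i < n} \<union> {(F i (Suc j), F i j) | i j. i < n} \<and>
     (\<forall>i<n. \<forall>i'<n. \<forall>j j'. F i j = F i' j' \<longleftrightarrow>
        i = i' \<and> j mod h = j' mod h \<or>
        i' = Suc i \<and> j mod h = d i \<and> j' mod h = 0 \<or>
        i = Suc i' \<and> j' mod h = d i' \<and> j mod h = 0)"

text \<open>
  The independent sets of the first \<open>i\<close> cycles that contain (\<open>b = True\<close>) or avoid the vertex where the next
  cycle is attached. The value at \<open>0\<close> is chosen so that the first cycle obeys the recursion as well.
\<close>
fun chain_count :: "nat \<Rightarrow> (nat \<Rightarrow> nat) \<Rightarrow> nat \<Rightarrow> bool \<Rightarrow> nat" where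
  "chain_count h d 0 b = 1"
| "chain_count h d (Suc i) b = (\<Sum>a\<in>UNIV. chain_count h d i a *
     (fib (d i + 1 - of_bool a - of_bool b) * fib (h - d i + 1 - of_bool a - of_bool b)))"

context
  fixes h n d and F :: "nat \<Rightarrow> nat \<Rightarrow> 'a" and G :: "('a, 'b) pre_digraph"
  assumes coords: "chain_coords h n d F G"
begin

lemma chain_coords_eq_iff:
  "i < n \<Longrightarrow> i' < n \<Longrightarrow> F i j = F i' j' \<longleftrightarrow>
     i = i' \<and> j mod h = j' mod h \<or>
     i' = Suc i \<and> j mod h = d i \<and> j' mod h = 0 \<or>
     i = Suc i' \<and> j' mod h = d i' \<and> j mod h = 0"
  using coords by (simp add: chain_coords_def)

lemma chain_coords_position: "i < n \<Longrightarrow> 0 < d i" "i < n \<Longrightarrow> d i < h"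
  using coords by (auto simp: chain_coords_def)

lemma chain_coords_image: "i < n \<Longrightarrow> F i ` {..<h} = range (F i)"
proof -
  assume i: "i < n"
  then have "F i j = F i (j mod h)" "j mod h < h" for j
    using chain_coords_position[OF i] by (auto simp: chain_coords_eq_iff)
  then show ?thesis by (metis (no_types, lifting) image_subset_iff lessThan_iff rangeI subsetI
    subset_antisym image_eqI rangeE)
qed

lemma chain_coords_path_edges: "i < n \<Longrightarrow> path_edges (F i) h = {(F i j, F i (Suc j)) | j. True}"
proof -
  assume i: "i < n"
  then have "F i j = F i (j mod h)" "F i (Suc j) = F i (Suc (j mod h))" "j mod h < h" for j
    using chain_coords_position[OF i] by (auto simp: chain_coords_eq_iff mod_Suc_eq)
  then show ?thesis unfolding path_edges_def by blast
qed

lemma indep_count_coords_cycle: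
  assumes i: "i < n"
  shows "indep_count (path_edges (F i) h) (F i ` {..<h}) (\<lambda>S. (F i 0 \<in> S) = a \<and> (F i (d i) \<in> S) = b)
     = fib (d i + 1 - of_bool a - of_bool b) * fib (h - d i + 1 - of_bool a - of_bool b)"
proof (rule indep_count_cycle)
  show "inj_on (F i) {..<h}" using i by (auto simp: inj_on_def chain_coords_eq_iff)
  show "F i h = F i 0" using i by (simp add: chain_coords_eq_iff)
qed (use chain_coords_position[OF i] in auto)

text \<open>The next cycle meets the union of the earlier ones only in \<open>F (Suc m) 0\<close>,
  so the counts glue for each state \<open>a\<close> of that vertex. In the base case vertex 0 is
  shared with no earlier cycle, and both of its states are summed with weight 1.\<close>

lemma indep_count_chain:
  assumes "m < n"
  shows "indep_count (\<Union>i<Suc m. path_edges (F i) h) (\<Union>i<Suc m. F i ` {..<h}) (\<lambda>S. (F m (d m) \<in> S) = b)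
    = chain_count h d (Suc m) b"
  using assms
proof (induction m arbitrary: b)
  case 0
  have "indep_count (path_edges (F 0) h) (F 0 ` {..<h}) (\<lambda>S. (F 0 (d 0) \<in> S) = b)
    = (\<Sum>a\<in>UNIV. indep_count (path_edges (F 0) h) (F 0 ` {..<h})
        (\<lambda>S. (F 0 0 \<in> S) = a \<and> (F 0 (d 0) \<in> S) = b))"
    by (subst indep_count_split[where Q = "\<lambda>S. F 0 0 \<in> S"]) (auto simp: UNIV_bool conj_commute)
  also have "\<dots> = chain_count h d (Suc 0) b"
    by (simp only: indep_count_coords_cycle[OF 0] chain_count.simps mult_1)
  finally show ?case by (simp only: lessThan_Suc lessThan_0 UN_insert UN_empty Un_empty_right)
next
  case (Suc m)
  then have m: "m < n" "Suc m < n" by auto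
  let ?E = "\<Union>i<Suc m. path_edges (F i) h" and ?V = "\<Union>i<Suc m. F i ` {..<h}"
  let ?e = "path_edges (F (Suc m)) h" and ?v = "F (Suc m) ` {..<h}"
  have link: "F (Suc m) 0 = F m (d m)"
    using m chain_coords_position[of m] by (simp add: chain_coords_eq_iff)
  have int: "x = F (Suc m) 0" if "x \<in> ?V" "x \<in> ?v" for x
    using that m by (auto simp: chain_coords_eq_iff)
  have mem: "F m (d m) \<in> ?V" "F (Suc m) 0 \<in> ?v" "F (Suc m) (d (Suc m)) \<in> ?v"
    using m chain_coords_position[of m] chain_coords_position[of "Suc m"] by auto
  have "indep_count (?E \<union> ?e) (?V \<union> ?v)
      (\<lambda>S. (F (Suc m) (d (Suc m)) \<in> S) = b \<and> (F (Suc m) 0 \<in> S) = a)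
    = indep_count ?E ?V (\<lambda>S. (F m (d m) \<in> S) = a) *
      indep_count ?e ?v (\<lambda>S. (F (Suc m) 0 \<in> S) = a \<and> (F (Suc m) (d (Suc m)) \<in> S) = b)" for a
  proof (rule indep_count_glue)
    have sub: "path_edges (F i) h \<subseteq> F i ` {..<h} \<times> F i ` {..<h}" if "i \<le> Suc m" for i
      using that m by (auto simp: chain_coords_image chain_coords_path_edges)
    show "?e \<subseteq> ?v \<times> ?v" by (rule sub) simp
    show "?E \<subseteq> ?V \<times> ?V"
    proof (rule UN_least)
      fix i assume i: "i \<in> {..<Suc m}"
      then have "path_edges (F i) h \<subseteq> F i ` {..<h} \<times> F i ` {..<h}" by (intro sub) simp
      also have "\<dots> \<subseteq> ?V \<times> ?V" using i by (intro Sigma_mono UN_upper)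
      finally show "path_edges (F i) h \<subseteq> ?V \<times> ?V" .
    qed
    show "x \<in> X \<longleftrightarrow> x \<in> Y" if "(F m (d m) \<in> X) = a"
      "(F (Suc m) 0 \<in> Y) = a \<and> (F (Suc m) (d (Suc m)) \<in> Y) = b" "x \<in> ?V" "x \<in> ?v" for X Y x
      using int[OF that(3,4)] that(1,2) link by simp
    show "((F (Suc m) (d (Suc m)) \<in> S) = b \<and> (F (Suc m) 0 \<in> S) = a) \<longleftrightarrow>
       ((F m (d m) \<in> S \<inter> ?V) = a) \<and>
       ((F (Suc m) 0 \<in> S \<inter> ?v) = a \<and> (F (Suc m) (d (Suc m)) \<in> S \<inter> ?v) = b)" for S
    proof -
      have "F m (d m) \<in> ?v" using mem(2) unfolding link .
      then show ?thesis by (simp only: Int_iff mem link simp_thms) blast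
    qed
  qed
  then have glue: "indep_count (?E \<union> ?e) (?V \<union> ?v)
      (\<lambda>S. (F (Suc m) (d (Suc m)) \<in> S) = b \<and> (F (Suc m) 0 \<in> S) = a)
    = chain_count h d (Suc m) a * (fib (d (Suc m) + 1 - of_bool a - of_bool b) *
        fib (h - d (Suc m) + 1 - of_bool a - of_bool b))" for a
    using m by (simp add: Suc.IH indep_count_coords_cycle del: chain_count.simps)
  have E: "(\<Union>i<Suc (Suc m). path_edges (F i) h) = ?E \<union> ?e" "(\<Union>i<Suc (Suc m). F i ` {..<h}) = ?V \<union> ?v"
    by (auto simp: lessThan_Suc)
  have "indep_count (?E \<union> ?e) (?V \<union> ?v) (\<lambda>S. (F (Suc m) (d (Suc m)) \<in> S) = b)
    = (\<Sum>a\<in>UNIV. indep_count (?E \<union> ?e) (?V \<union> ?v)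
        (\<lambda>S. (F (Suc m) (d (Suc m)) \<in> S) = b \<and> (F (Suc m) 0 \<in> S) = a))"
    by (subst indep_count_split[where Q = "\<lambda>S. F (Suc m) 0 \<in> S"]) (auto simp: UNIV_bool)
  then show ?case unfolding E glue by simp
qed

lemma num_independent_sets_chain:
  assumes "0 < n"
  shows "\<Psi> G = (\<Sum>b\<in>UNIV. chain_count h d n b)"
proof -
  obtain m where m: "n = Suc m" using assms by (cases n) auto
  let ?E = "\<Union>i<n. path_edges (F i) h" and ?V = "\<Union>i<n. F i ` {..<h}"
  have V: "verts G = ?V" using coords by (auto simp: chain_coords_def chain_coords_image)
  have E: "arcs_ends G = ?E \<union> ?E\<inverse>"
    using coords by (auto simp: chain_coords_def chain_coords_path_edges)
  \<comment> \<open>One orientation per edge is enough, because the condition on an edge is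
    symmetric in its ends.\<close>
  have "independent_set G S \<longleftrightarrow> S \<subseteq> ?V \<and> (\<forall>(u, v)\<in>?E. u \<notin> S \<or> v \<notin> S)" for S
    unfolding independent_set_def V E by blast
  then have "\<Psi> G = indep_count ?E ?V (\<lambda>_. True)"
    by (simp add: num_independent_sets_def indep_count_def)
  also have "\<dots> = (\<Sum>b\<in>UNIV. indep_count ?E ?V (\<lambda>S. (F m (d m) \<in> S) = b))"
    by (subst indep_count_split[where Q = "\<lambda>S. F m (d m) \<in> S"]) (auto simp: UNIV_bool)
  also have "\<dots> = (\<Sum>b\<in>UNIV. chain_count h d n b)"
    using indep_count_chain[of m] m by simp
  finally show ?thesis .
qed

end

section \<open>Fibonacci estimates and monotonicity of the recursion\<close>

lemma fib_mult_Suc: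
  assumes "0 < k" "k < h"
  shows "fib (k + 1) * fib (h - k + 1) + fib k * fib (h - k) = fib (h + 1)"
  using fib_add[of "h - k" k] assms by (simp add: mult.commute)

lemma fib_mult_pred:
  assumes "0 < k" "k < h"
  shows "fib k * fib (h - k) + fib (k - 1) * fib (h - k - 1) = fib (h - 1)"
proof -
  obtain k' l' where "k = Suc k'" "h = k + Suc l'"
    using assms by (metis less_imp_Suc_add add_Suc_right gr0_conv_Suc)
  then show ?thesis using fib_add[of l' k'] by (simp add: mult.commute add.commute)
qed

text \<open>The addition formula eliminates the diagonal product in favour of the off-diagonal
  product \<open>p\<close>, so that the position enters through \<open>p\<close> only. Integers are
  used because \<open>p\<close> is subtracted.\<close>

lemma int_chain_count_False:
  assumes "0 < d i" "d i < h"
  shows "int (chain_count h d (Suc i) False) =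
    int (chain_count h d i False) * fib (h + 1) - int (fib (d i) * fib (h - d i)) *
      (int (chain_count h d i False) - int (chain_count h d i True))"
proof -
  have 1: "int (fib (d i + 1) * fib (h - d i + 1)) = int (fib (h + 1)) - int (fib (d i) * fib (h - d i))"
    using fib_mult_Suc[OF assms] by linarith
  have 2: "int (chain_count h d (Suc i) False) =
      int (chain_count h d i False) * int (fib (d i + 1) * fib (h - d i + 1)) +
      int (chain_count h d i True) * int (fib (d i) * fib (h - d i))"
    by (simp add: UNIV_bool)
  show ?thesis unfolding 2 1 by (simp only: algebra_simps of_nat_mult)
qed

lemma int_chain_count_True:
  assumes "0 < d i" "d i < h"
  shows "int (chain_count h d (Suc i) True) =
    int (chain_count h d i True) * fib (h - 1) + int (fib (d i) * fib (h - d i)) *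
      (int (chain_count h d i False) - int (chain_count h d i True))"
proof -
  have 1: "int (fib (d i - 1) * fib (h - d i - 1)) = int (fib (h - 1)) - int (fib (d i) * fib (h - d i))"
    using fib_mult_pred[OF assms] by linarith
  have 2: "int (chain_count h d (Suc i) True) =
      int (chain_count h d i False) * int (fib (d i) * fib (h - d i)) +
      int (chain_count h d i True) * int (fib (d i - 1) * fib (h - d i - 1))"
    by (simp add: UNIV_bool)
  show ?thesis unfolding 2 1 by (simp only: algebra_simps of_nat_mult)
qed

text \<open>One of \<open>k\<close> and \<open>l\<close> is at least 2, where \<open>fib\<close> is
  strictly increasing; \<open>k = l = 1\<close> has to be excluded because
  \<open>fib 1 = fib 2\<close>.\<close>

lemma fib_mult_less:
  assumes "0 < k" "0 < l" "3 \<le> k + l"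
  shows "fib k * fib l < fib (k + 1) * fib (l + 1)"
proof -
  have less: "fib m < fib (m + 1)" if "2 \<le> m" for m
  proof -
    obtain m' where "m = 2 + m'" using \<open>2 \<le> m\<close> le_Suc_ex by blast
    then show ?thesis using fib_neq_0_nat[of "Suc m'"] by simp
  qed
  have le: "fib m \<le> fib (m + 1)" for m using fib_mono[of m "m + 1"] by simp
  have pos: "0 < fib k" "0 < fib l" using assms by (simp_all add: fib_neq_0_nat)
  consider "2 \<le> k" | "2 \<le> l" using assms by linarith
  then show ?thesis
  proof cases
    case 1
    show ?thesis by (rule mult_less_le_imp_less[OF less[OF 1] le _ pos(2)]) simp
  next
    case 2
    show ?thesis by (rule mult_le_less_imp_less[OF le less[OF 2] pos(1)]) simp
  qed
qed

text \<open>Entrywise the coefficients for \<open>False\<close> dominate those for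
  \<open>True\<close>, strictly in the one multiplied by the positive count \<open>?x\<close>. The
  equality at index 0 comes from the initial values; it is the reason why the position inside the
  first cycle has no effect.\<close>

lemma chain_count_False_pos_less:
  assumes h: "3 \<le> h" and d: "\<And>i. i < m \<Longrightarrow> 0 < d i \<and> d i < h"
  shows "0 < chain_count h d m False \<and>
     (if m = 0 then chain_count h d m True = chain_count h d m False
      else chain_count h d m True < chain_count h d m False)"
  using d
proof (induction m)
  case (Suc m)
  let ?x = "chain_count h d m False" and ?y = "chain_count h d m True"
  let ?k = "d m" and ?l = "h - d m"
  have k: "0 < ?k" "0 < ?l" "3 \<le> ?k + ?l" using Suc.prems[of m] h by auto
  have x: "0 < ?x" using Suc by auto
  have p: "fib ?k * fib ?l < fib (?k + 1) * fib (?l + 1)" using fib_mult_less[OF k] .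
  have q: "fib (?k - 1) * fib (?l - 1) \<le> fib ?k * fib ?l" by (intro mult_mono fib_mono) auto
  have eq: "chain_count h d (Suc m) False = ?x * (fib (?k + 1) * fib (?l + 1)) + ?y * (fib ?k * fib ?l)"
    "chain_count h d (Suc m) True = ?x * (fib ?k * fib ?l) + ?y * (fib (?k - 1) * fib (?l - 1))"
    by (simp_all add: UNIV_bool)
  have "chain_count h d (Suc m) True < chain_count h d (Suc m) False"
    unfolding eq using x p q by (intro add_less_le_mono mult_strict_left_mono mult_left_mono) auto
  moreover have "0 < chain_count h d (Suc m) False"
    unfolding eq using x k by (intro add_pos_nonneg mult_pos_pos fib_neq_0_nat) auto
  ultimately show ?case by (simp del: chain_count.simps)
qed simp

lemma chain_count_mono:
  assumes h: "3 \<le> h"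
    and d: "\<And>i. i < n \<Longrightarrow> 0 < d i \<and> d i < h" and d': "\<And>i. i < n \<Longrightarrow> 0 < d' i \<and> d' i < h"
    and le: "\<And>i. i < n \<Longrightarrow> fib (d i) * fib (h - d i) \<le> fib (d' i) * fib (h - d' i)"
    and less: "0 < j" "Suc j < n" "fib (d j) * fib (h - d j) < fib (d' j) * fib (h - d' j)"
  shows "(\<Sum>b\<in>UNIV. chain_count h d' n b) < (\<Sum>b\<in>UNIV. chain_count h d n b)"
proof -
  let ?o = "\<lambda>d i. int (chain_count h d i False)" and ?i = "\<lambda>d i. int (chain_count h d i True)"
  let ?s = "\<lambda>d i. ?o d i + ?i d i"
  let ?p = "\<lambda>d i. int (fib (d i) * fib (h - d i))"
  have F: "int (fib (h + 1)) = int (fib h) + int (fib (h - 1))"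
    using h by (cases h) auto
  have Fpos: "0 < int (fib h)" "0 < int (fib (h - 1))" using h by (simp_all add: fib_neq_0_nat)
  have s_Suc: "?s d (Suc i) = ?s d i * fib (h - 1) + ?o d i * fib h" if "0 < d i" "d i < h" for d i
    unfolding int_chain_count_False[of d i, OF that] int_chain_count_True[of d i, OF that] F
    by (simp add: algebra_simps)
  have sd: "?s d (Suc i) = ?s d i * fib (h - 1) + ?o d i * fib h" if "i < n" for i
    by (rule s_Suc) (use d[OF that] in auto)
  have sd': "?s d' (Suc i) = ?s d' i * fib (h - 1) + ?o d' i * fib h" if "i < n" for i
    by (rule s_Suc) (use d'[OF that] in auto)
  have o_Suc: "?o d (Suc i) = ?o d i * fib (h + 1) - ?p d i * (2 * ?o d i - ?s d i)"
    if "0 < d i" "d i < h" for d i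
    unfolding int_chain_count_False[of d i, OF that] by simp
  have step: "?o d' (Suc i) \<le> ?o d (Suc i) \<and>
     (0 < i \<and> ?p d i < ?p d' i \<longrightarrow> ?o d' (Suc i) < ?o d (Suc i))"
    if i: "i < n" and o: "?o d' i \<le> ?o d i" and s: "?s d' i \<le> ?s d i" for i
  proof -
    \<comment> \<open>The two products compared here add up to \<open>fib (h + 1)\<close>, so the
      smaller one is at most half of it.\<close>
    have "fib (d i) * fib (h - d i) < fib (d i + 1) * fib (h - d i + 1)"
      using d[OF i] h by (intro fib_mult_less) auto
    then have "2 * (fib (d i) * fib (h - d i)) \<le> fib (h + 1)"
      using fib_mult_Suc[of "d i" h] d[OF i] by linarith
    then have a: "0 \<le> int (fib (h + 1)) - 2 * ?p d i" by linarith
    \<comment> \<open>The comparison has two stages: here the state changes while the parameter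
      stays that of \<open>d\<close>, afterwards the parameter changes while the state stays that of
      \<open>d'\<close>.\<close>
    have "?o d (Suc i) - (?o d' i * fib (h + 1) - ?p d i * (2 * ?o d' i - ?s d' i))
      = (?o d i - ?o d' i) * (fib (h + 1) - 2 * ?p d i) + ?p d i * (?s d i - ?s d' i)"
      using o_Suc[of d i] d[OF i] by (simp add: algebra_simps)
    also have "\<dots> \<ge> 0" using a o s by (intro add_nonneg_nonneg mult_nonneg_nonneg) auto
    finally have 1: "?o d' i * fib (h + 1) - ?p d i * (2 * ?o d' i - ?s d' i) \<le> ?o d (Suc i)" by simp
    have 2: "?o d' (Suc i) = ?o d' i * fib (h + 1) - ?p d' i * (2 * ?o d' i - ?s d' i)"
      using o_Suc[of d' i] d'[OF i] by simp
    \<comment> \<open>This quantity is the count avoiding the attaching vertex minus the count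
      containing it. It vanishes at index 0, hence the condition \<open>0 < i\<close>.\<close>
    have 3: "0 \<le> 2 * ?o d' i - ?s d' i" "0 < i \<Longrightarrow> 0 < 2 * ?o d' i - ?s d' i"
      using chain_count_False_pos_less[OF h, of i d'] d' i by (auto split: if_splits)
    have "?p d i \<le> ?p d' i" using le[OF i] by (simp only: of_nat_le_iff)
    then have "?p d i * (2 * ?o d' i - ?s d' i) \<le> ?p d' i * (2 * ?o d' i - ?s d' i)"
      by (rule mult_right_mono) (rule 3)
    moreover have "?p d i * (2 * ?o d' i - ?s d' i) < ?p d' i * (2 * ?o d' i - ?s d' i)"
      if "0 < i" "?p d i < ?p d' i"
      by (rule mult_strict_right_mono[OF that(2) 3(2)[OF that(1)]])
    ultimately show ?thesis using 1 2 by linarith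
  qed
  have mono: "?o d' i \<le> ?o d i \<and> ?s d' i \<le> ?s d i" if "i \<le> n" for i
    using that
  proof (induction i)
    case (Suc i)
    then have i: "i < n" and IH: "?o d' i \<le> ?o d i" "?s d' i \<le> ?s d i" by auto
    have "?s d' (Suc i) \<le> ?s d (Suc i)"
      unfolding sd[OF i] sd'[OF i] by (rule add_mono[OF mult_right_mono[OF IH(2)] mult_right_mono[OF IH(1)]]) simp_all
    then show ?case using step[OF i IH] by blast
  qed simp
  \<comment> \<open>A difference at cycle \<open>j\<close> shows in \<open>?o\<close> at index
    \<open>Suc j\<close> and in the sum one cycle later, since the sum sees only the preceding
    \<open>?o\<close>. So another cycle must follow, which is \<open>Suc j < n\<close>.\<close>
  have "?s d' i < ?s d i" if "Suc (Suc j) \<le> i" "i \<le> n" for i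
    using that
  proof (induction i rule: dec_induct)
    case base
    have jn: "j < n" using less by simp
    have o: "?o d' (Suc j) < ?o d (Suc j)"
    proof -
      have "?p d j < ?p d' j" using less(3) by (simp only: of_nat_less_iff)
      then show ?thesis using step[OF jn] mono[of j] less(1) jn by (simp only: less_imp_le simp_thms)
    qed
    show ?case
      unfolding sd[OF less(2)] sd'[OF less(2)]
      by (rule add_le_less_mono[OF mult_right_mono mult_strict_right_mono[OF o Fpos(1)]])
        (use mono[of "Suc j"] less(2) in \<open>simp_all del: chain_count.simps\<close>)
  next
    case (step i)
    then have i: "i < n" and IH: "?s d' i < ?s d i" by auto
    show ?case
      unfolding sd[OF i] sd'[OF i]
      by (rule add_less_le_mono[OF mult_strict_right_mono[OF IH Fpos(2)] mult_right_mono])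
        (use mono[of i] i in simp_all)
  qed
  from this[of n] less have "?s d' n < ?s d n" by simp
  then show ?thesis by (simp add: UNIV_bool)
qed

text \<open>The value at distance 1 is \<open>fib (h - 1)\<close>, which the addition formula writes
  as the value at \<open>k\<close> plus a product that is positive once \<open>k\<close> and
  \<open>h - k\<close> are at least 2.\<close>

lemma fib_mult_less_ortho:
  assumes "2 \<le> k" "2 * k \<le> h"
  shows "fib k * fib (h - k) < fib 1 * fib (h - 1)"
proof -
  have "0 < fib (k - 1) * fib (h - k - 1)"
    using assms by (intro mult_pos_pos fib_neq_0_nat) auto
  moreover have "fib k * fib (h - k) + fib (k - 1) * fib (h - k - 1) = fib (h - 1)"
    using assms by (intro fib_mult_pred) auto
  ultimately show ?thesis unfolding fib_1 mult_1 by linarith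
qed

text \<open>The value at distance 2 is \<open>fib (h - 2)\<close>. For \<open>k\<close> at least 3
  the addition formula expands it so that the gap to the value at \<open>k\<close> is
  \<open>fib (k - 2) * fib (h - k - 2)\<close>, where \<open>2 * k <= h\<close> keeps
  \<open>h - k\<close> at least 3. For \<open>k = 1\<close> the gap is \<open>fib (h - 3)\<close>,
  positive since \<open>h\<close> is at least 4.\<close>

lemma fib_mult_greater_meta:
  assumes "1 \<le> k" "k \<noteq> 2" "2 * k \<le> h" "4 \<le> h"
  shows "fib 2 * fib (h - 2) < fib k * fib (h - k)"
proof (cases "k = 1")
  case True
  obtain m where "h = 4 + m" using assms(4) le_Suc_ex by blast
  then show ?thesis using True fib_neq_0_nat[of "Suc m"] by (simp add: numeral_eq_Suc)
next
  case False
  with assms have "3 \<le> k" "3 \<le> h - k" by auto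
  then obtain m l where m: "k = m + 3" and l: "h - k = l + 3" by (metis le_add_diff_inverse2)
  have h2: "h - 2 = Suc ((l + 1) + (m + 2))" using m l by simp
  have "fib (h - 2) = fib (m + 3) * fib (l + 2) + fib (m + 2) * fib (l + 1)"
    unfolding h2 fib_add by (simp add: numeral_eq_Suc)
  moreover have "fib (l + 3) = fib (l + 2) + fib (l + 1)" "fib (m + 3) = fib (m + 2) + fib (m + 1)"
    by (simp_all add: numeral_eq_Suc)
  moreover have "0 < fib (m + 1) * fib (l + 1)" by (simp add: fib_neq_0_nat)
  ultimately show ?thesis unfolding l by (simp add: m algebra_simps)
qed

section \<open>Blocks and cyclically linked cycles\<close>

abbreviation nonseparable :: "('a, 'b) pre_digraph \<Rightarrow> bool" where
  "nonseparable H \<equiv> symmetric H \<and> connected H \<and> (\<nexists>v. cut_vertex H v)"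

lemma connected_iff_reachable:
  assumes "wf_digraph H" "symmetric H"
  shows "connected H \<longleftrightarrow> verts H \<noteq> {} \<and> (\<forall>u\<in>verts H. \<forall>v\<in>verts H. u \<rightarrow>\<^sup>*\<^bsub>H\<^esub> v)"
  unfolding connected_def strongly_connected_def
  using wf_digraph.reachable_mk_symmetric_eq[OF assms] by simp

lemma subgraph_del_vert_mono:
  assumes "subgraph B H"
  shows "subgraph (pre_digraph.del_vert B y) (pre_digraph.del_vert H y)"
  using assms unfolding subgraph_def compatible_def
  by (auto simp: pre_digraph.del_vert_simps wf_digraph.wf_digraph_del_vert)

lemma symmetric_del_vert:
  assumes "symmetric H"
  shows "symmetric (pre_digraph.del_vert H y)"
  using assms unfolding symmetric_conv by (fastforce simp: pre_digraph.del_vert_simps)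

lemma nonseparable_reachable_del_vert:
  assumes wf: "wf_digraph H" and ns: "nonseparable H" and "u \<in> verts H - {y}" "w \<in> verts H - {y}"
  shows "u \<rightarrow>\<^sup>*\<^bsub>pre_digraph.del_vert H y\<^esub> w"
proof -
  have reach: "u \<rightarrow>\<^sup>*\<^bsub>H\<^esub> w" using assms connected_iff_reachable[of H] by blast
  show ?thesis
  proof (cases "y \<in> verts H")
    case True
    then show ?thesis using ns reach assms(3,4) unfolding cut_vertex_def by blast
  next
    case False
    then have "pre_digraph.del_vert H y = H"
      using wf by (auto simp: pre_digraph.del_vert_def wf_digraph_def intro!: pre_digraph.equality)
    then show ?thesis using reach by simp
  qed
qed

text \<open>With link \<open>j\<close> removed the closed chain becomes a path: from
  \<open>S i\<close> with \<open>i <= j\<close> one descends to \<open>S 0\<close>, and otherwise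
  one ascends to \<open>S m\<close> and passes the closing link \<open>x m\<close>. \<open>R\<close>
  stands for reachability, either in the whole union (with \<open>j = m\<close>) or after deleting a
  vertex.\<close>

lemma cyclic_links_related:
  fixes S :: "nat \<Rightarrow> 'a set" and x :: "nat \<Rightarrow> 'a"
  assumes trans: "\<And>a b c. R a b \<Longrightarrow> R b c \<Longrightarrow> R a c"
    and within: "\<And>i a b. i \<le> m \<Longrightarrow> a \<in> S i \<Longrightarrow> b \<in> S i \<Longrightarrow> R a b"
    and links: "\<And>i. i < m \<Longrightarrow> i \<noteq> j \<Longrightarrow> x i \<in> S i \<inter> S (Suc i)"
    and closing: "m \<noteq> j \<Longrightarrow> x m \<in> S m \<inter> S 0"
    and i: "i \<le> m" "a \<in> S i" and z: "z \<in> S 0" and j: "j \<le> m"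
  shows "R a z"
proof (cases "i \<le> j")
  case True
  then show ?thesis using i(2)
  proof (induction i arbitrary: a)
    case 0
    then show ?case using within z by blast
  next
    case (Suc i)
    then have "x i \<in> S i \<inter> S (Suc i)" using links[of i] j by auto
    then show ?case using Suc.IH[of "x i"] Suc.prems within[of "Suc i" a "x i"] j trans by auto
  qed
next
  case False
  then have mj: "m \<noteq> j" using i by auto
  have "R a (x m)" using i False
  proof (induction arbitrary: a rule: inc_induct)
    case base
    then show ?case using within closing[OF mj] by blast
  next
    case (step k)
    then have "x k \<in> S k \<inter> S (Suc k)" using links[of k] by auto
    then show ?case using step.IH[of "x k"] step.prems step.hyps within[of k a "x k"] trans by auto
  qed
  moreover have "R (x m) z" using within[of 0] closing[OF mj] z by blast
  ultimately show ?thesis by (rule trans)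
qed

text \<open>Deleting a vertex destroys at most one link of the closed chain, and the rest stays linked.\<close>
lemma nonseparable_cyclic_union:
  fixes B :: "nat \<Rightarrow> ('a, 'b) pre_digraph" and x :: "nat \<Rightarrow> 'a"
  assumes wf: "wf_digraph G"
    and sub: "\<And>i. i \<le> m \<Longrightarrow> subgraph (B i) G" and ns: "\<And>i. i \<le> m \<Longrightarrow> nonseparable (B i)"
    and links: "\<And>i. i < m \<Longrightarrow> x i \<in> verts (B i) \<inter> verts (B (Suc i))"
    and closing: "x m \<in> verts (B m) \<inter> verts (B 0)"
    and inj: "inj_on x {..m}"
  obtains H where "subgraph H G" "nonseparable H" "\<And>i. i \<le> m \<Longrightarrow> subgraph (B i) H"
proof -
  define H where "H = \<lparr> verts = (\<Union>i\<le>m. verts (B i)), arcs = (\<Union>i\<le>m. arcs (B i)), tail = tail G, head = head G \<rparr>"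
  have B: "wf_digraph (B i)" "tail (B i) = tail G" "head (B i) = head G" "verts (B i) \<subseteq> verts G"
    "arcs (B i) \<subseteq> arcs G" if "i \<le> m" for i
    using sub[OF that] by (auto simp: subgraph_def compatible_def)
  have wfH: "wf_digraph H"
  proof
    fix e assume "e \<in> arcs H"
    then obtain i where i: "i \<le> m" "e \<in> arcs (B i)" by (auto simp: H_def)
    then have "tail (B i) e \<in> verts (B i)" "head (B i) e \<in> verts (B i)"
      using B(1)[of i] by (auto simp: wf_digraph_def)
    then show "tail H e \<in> verts H" "head H e \<in> verts H" using B(2,3)[of i] i by (auto simp: H_def)
  qed
  have subH: "subgraph H G"
    using B wf wfH by (fastforce simp: subgraph_def compatible_def H_def)
  have BH: "subgraph (B i) H" if "i \<le> m" for i
    using B[OF that] wfH that by (auto simp: subgraph_def compatible_def H_def)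
  have symH: "symmetric H"
    unfolding symmetric_def
  proof (rule symI)
    fix a b assume "(a, b) \<in> arcs_ends H"
    then obtain i where i: "i \<le> m" "(a, b) \<in> arcs_ends (B i)"
      using B(2,3) by (fastforce simp: arcs_ends_conv H_def)
    then have "(b, a) \<in> arcs_ends (B i)" using ns by (blast intro: arcs_ends_symmetric)
    then show "(b, a) \<in> arcs_ends H" using arcs_ends_mono[OF BH[OF i(1)]] by blast
  qed
  have "connected H"
    unfolding connected_iff_reachable[OF wfH symH]
  proof (intro conjI ballI)
    show "verts H \<noteq> {}" using closing by (auto simp: H_def)
    have to: "a \<rightarrow>\<^sup>*\<^bsub>H\<^esub> x m" if a: "a \<in> verts H" for a
    proof -
      obtain i where i: "i \<le> m" "a \<in> verts (B i)" using a by (auto simp: H_def)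
      show ?thesis
      proof (rule cyclic_links_related[where S = "\<lambda>i. verts (B i)" and x = x and m = m and j = m])
        show "a \<rightarrow>\<^sup>*\<^bsub>H\<^esub> b" if "i \<le> m" "a \<in> verts (B i)" "b \<in> verts (B i)" for i a b
          using pre_digraph.reachable_mono[OF _ BH] connected_iff_reachable[of "B i"] B(1) ns that by blast
      qed (use wf_digraph.reachable_trans[OF wfH] links closing i in auto)
    qed
    fix u v assume "u \<in> verts H" "v \<in> verts H"
    then show "u \<rightarrow>\<^sup>*\<^bsub>H\<^esub> v"
      using to symmetric_reachable[OF symH] wf_digraph.reachable_trans[OF wfH] by blast
  qed
  moreover have "\<not> cut_vertex H y" for y
  proof
    let ?D = "pre_digraph.del_vert H y"
    assume "cut_vertex H y"
    then obtain u w where uw: "u \<in> verts H - {y}" "w \<in> verts H - {y}" "\<not> u \<rightarrow>\<^sup>*\<^bsub>?D\<^esub> w"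
      by (auto simp: cut_vertex_def)
    have wfD: "wf_digraph ?D" using wf_digraph.wf_digraph_del_vert[OF wfH] .
    have within: "a \<rightarrow>\<^sup>*\<^bsub>?D\<^esub> b" if "i \<le> m" "a \<in> verts (B i) - {y}" "b \<in> verts (B i) - {y}" for i a b
      using pre_digraph.reachable_mono[OF _ subgraph_del_vert_mono[OF BH]]
        nonseparable_reachable_del_vert[OF B(1) ns] that by blast
    \<comment> \<open>By injectivity at most one link vertex is \<open>y\<close>; \<open>j\<close>
      is its index, or any index if there is none.\<close>
    obtain j where j: "j \<le> m" "\<And>i. i \<le> m \<Longrightarrow> i \<noteq> j \<Longrightarrow> x i \<noteq> y"
      using inj by (metis atMost_iff inj_onD order_refl)
    have to: "a \<rightarrow>\<^sup>*\<^bsub>?D\<^esub> z" if a: "a \<in> verts H - {y}" and z: "z \<in> verts (B 0) - {y}" for a z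
    proof -
      obtain i where i: "i \<le> m" "a \<in> verts (B i) - {y}" using a by (auto simp: H_def)
      show ?thesis
      proof (rule cyclic_links_related[where S = "\<lambda>i. verts (B i) - {y}" and x = x and m = m and j = j])
        show "x i \<in> (verts (B i) - {y}) \<inter> (verts (B (Suc i)) - {y})" if "i < m" "i \<noteq> j" for i
          using links[of i] j(2)[of i] that by auto
        show "x m \<in> (verts (B m) - {y}) \<inter> (verts (B 0) - {y})" if "m \<noteq> j"
          using closing j(2)[of m] that by auto
        show "a \<rightarrow>\<^sup>*\<^bsub>?D\<^esub> c" if "a \<rightarrow>\<^sup>*\<^bsub>?D\<^esub> b" "b \<rightarrow>\<^sup>*\<^bsub>?D\<^esub> c" for a b c
          by (rule wf_digraph.reachable_trans[OF wfD that])
        show "a \<rightarrow>\<^sup>*\<^bsub>?D\<^esub> b" if "i \<le> m" "a \<in> verts (B i) - {y}" "b \<in> verts (B i) - {y}" for i a b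
          by (rule within[OF that])
      qed (fact i z j)+
    qed
    show False
    proof (cases "m = 0")
      case True
      then show ?thesis using uw within[of 0 u w] by (auto simp: H_def)
    next
      case False
      \<comment> \<open>Every remaining vertex reaches \<open>B 0\<close>. Joining two of them there
        needs a vertex of \<open>B 0\<close> other than \<open>y\<close>, and one of the distinct
        \<open>x 0\<close> and \<open>x m\<close> serves.\<close>
      then have "x 0 \<noteq> x m" using inj by (auto simp: inj_on_def)
      moreover have "x 0 \<in> verts (B 0)" "x m \<in> verts (B 0)" using links[of 0] closing False by auto
      ultimately obtain z where "z \<in> verts (B 0) - {y}" by auto
      then have "u \<rightarrow>\<^sup>*\<^bsub>?D\<^esub> w"
        using to uw symmetric_reachable[OF symmetric_del_vert[OF symH]]
          wf_digraph.reachable_trans[OF wfD] by blast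
      then show False using uw by simp
    qed
  qed
  ultimately show ?thesis using that[OF subH _ BH] symH by blast
qed

text \<open>A nonseparable supergraph inside \<open>G\<close> that maximises the number of vertices
  plus arcs is a block: a further extension would have the same two cardinalities, hence the same
  vertices and arcs.\<close>

lemma nonseparable_subgraph_of_block:
  assumes fin: "fin_digraph G" and sub: "subgraph H G" and ns: "nonseparable H"
  obtains B where "block G B" "subgraph H B"
proof -
  interpret fin_digraph G by (rule fin)
  let ?P = "\<lambda>K. subgraph H K \<and> subgraph K G \<and> nonseparable K"
  let ?f = "\<lambda>K :: ('a, 'b) pre_digraph. card (verts K) + card (arcs K)"
  have H: "?P H" using sub ns wf_digraph.subgraph_refl by (auto simp: subgraph_def compatible_def)
  have bound: "?f K \<le> ?f G" if "subgraph K G" for K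
    using that by (auto simp: subgraph_def intro!: add_mono card_mono)
  have "\<exists>K. ?P K \<and> (\<forall>K'. ?P K' \<longrightarrow> ?f K' \<le> ?f K)"
    by (rule ex_has_greatest_nat[of ?P H _ "Suc (?f G)"]) (use H bound in \<open>simp_all add: less_Suc_eq_le\<close>)
  then obtain K where K: "?P K" "\<And>K'. ?P K' \<Longrightarrow> ?f K' \<le> ?f K" by metis
  have "K' = K" if "subgraph K K'" "subgraph K' G" "nonseparable K'" for K'
  proof -
    have le: "?f K' \<le> ?f K" using K that by (blast intro: subgraph_trans)
    have fin: "finite (verts K')" "finite (arcs K')" "verts K \<subseteq> verts K'" "arcs K \<subseteq> arcs K'"
      using that finite_subset[OF _ finite_verts] finite_subset[OF _ finite_arcs]
      by (auto simp: subgraph_def)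
    have "card (verts K') \<le> card (verts K)" "card (arcs K') \<le> card (arcs K)"
      using le card_mono[OF fin(1,3)] card_mono[OF fin(2,4)] by linarith+
    then have "verts K = verts K'" "arcs K = arcs K'"
      using card_seteq[OF fin(1,3)] card_seteq[OF fin(2,4)] by auto
    then show ?thesis using that(1) by (simp add: subgraph_def compatible_def)
  qed
  then have "block G K" using K unfolding block_def pre_digraph.max_subgraph_def by blast
  then show ?thesis using that K by blast
qed

text \<open>A single edge, taken with its reverse arc, is already nonseparable, because deleting one
  end leaves a single vertex. In a chain cactus, where blocks are cycles, this puts every edge on a
  cycle.\<close>

lemma arc_in_block:
  assumes "graph G" "e \<in> arcs G"
  obtains B where "block G B" "e \<in> arcs B"
proof -
  interpret graph G by fact
  obtain e' where e': "e' \<in> arcs G" "tail G e = head G e'" "head G e = tail G e'"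
    using sym_arcs assms(2) unfolding symmetric_conv by blast
  define H where "H = \<lparr> verts = {tail G e, head G e}, arcs = {e, e'}, tail = tail G, head = head G \<rparr>"
  have wfH: "wf_digraph H" using e' by unfold_locales (auto simp: H_def)
  have sub: "subgraph H G"
    using wfH e' assms(2) by (auto simp: subgraph_def compatible_def H_def wf_digraph_axioms)
  have ends: "arcs_ends H = {(tail G e, head G e), (head G e, tail G e)}"
    using e' by (auto simp: arcs_ends_conv H_def)
  then have symH: "symmetric H" by (auto simp: symmetric_def sym_def)
  have "connected H"
    unfolding connected_iff_reachable[OF wfH symH]
    using wf_digraph.reachable_adjI[OF wfH] wf_digraph.reachable_refl[OF wfH] ends
    by (auto simp: H_def)
  moreover have "\<not> cut_vertex H v" for v
    using wf_digraph.reachable_refl[OF wf_digraph.wf_digraph_del_vert[OF wfH, of v]]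
    by (auto simp: cut_vertex_def pre_digraph.del_vert_simps H_def)
  ultimately have "nonseparable H" using symH by blast
  then obtain B where "block G B" "subgraph H B"
    using nonseparable_subgraph_of_block[OF _ sub] fin_digraph_axioms by blast
  then show ?thesis using that by (auto simp: subgraph_def H_def)
qed

text \<open>The numbering is periodic on all of \<open>nat\<close>, so rotations and reflections are
  reindexings and the closing edge is no special case.\<close>

definition cycle_coords :: "nat \<Rightarrow> (nat \<Rightarrow> 'a) \<Rightarrow> ('a, 'b) pre_digraph \<Rightarrow> bool" where
  "cycle_coords h g C \<longleftrightarrow>
     (\<forall>i j. g i = g j \<longleftrightarrow> i mod h = j mod h) \<and> verts C = range g \<and>
     arcs_ends C = {(g j, g (Suc j)) | j. True} \<union> {(g (Suc j), g j) | j. True}"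

lemma cycle_graph_coords:
  assumes "cycle_graph C"
  obtains h g where "3 \<le> h" "card (verts C) = h" "cycle_coords h g C"
proof -
  from assms obtain p u where C: "graph C" and u: "pre_digraph.awalk C u p u"
    and dist: "distinct (tl (pre_digraph.awalk_verts C u p))" and len: "3 \<le> length p"
    and V: "verts C = tail C ` set p"
    and E: "arcs_ends C = arc_to_ends C ` set p \<union> (arc_to_ends C ` set p)\<inverse>"
    unfolding cycle_graph_def pre_digraph.cycle_def by blast
  interpret graph C by fact
  define h where "h = length p"
  define g where "g j = tail C (p ! (j mod h))" for j
  have h: "3 \<le> h" and p: "p \<noteq> []" using len by (auto simp: h_def)
  have mod: "j mod h < length p" for j using len unfolding h_def by (intro mod_less_divisor) linarith
  have cas: "cas u p u" using u by (simp add: awalk_def)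
  have vs: "awalk_verts u p = map (tail C) p @ [head C (last p)]"
    "awalk_verts u p = tail C (hd p) # map (head C) p"
    using awalk_verts_conv[of u p] awalk_verts_conv'[OF cas] p by auto
  have last: "head C (last p) = tail C (hd p)"
    using awlast_if_cas[OF cas, unfolded vs(1)] awhd_if_cas[OF cas, unfolded vs(2)] by simp
  have head: "head C (p ! (j mod h)) = g (Suc j)" for j
  proof (cases "Suc (j mod h) < h")
    case True
    have "awalk_verts u p ! Suc (j mod h) = head C (p ! (j mod h))" unfolding vs(2) using mod by simp
    moreover have "awalk_verts u p ! Suc (j mod h) = tail C (p ! Suc (j mod h))"
      unfolding vs(1) using True by (simp add: h_def nth_append)
    moreover have "Suc j mod h = Suc (j mod h)" using True by (simp add: mod_Suc)
    ultimately show ?thesis by (simp add: g_def)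
  next
    case False
    then have j: "Suc (j mod h) = h" using mod[of j] by (simp add: h_def)
    then have "Suc j mod h = 0" by (simp add: mod_Suc)
    moreover have "p ! (j mod h) = last p" using j p by (metis h_def diff_Suc_1 last_conv_nth)
    ultimately show ?thesis using last p by (simp add: g_def hd_conv_nth)
  qed
  \<comment> \<open>\<open>cycle\<close> makes the vertex list without its first entry distinct,
    that is, the heads of the arcs. Injectivity is therefore obtained first for the shifted
    numbering and then moved back by one period.\<close>
  have inj_Suc: "g (Suc i) = g (Suc j) \<longleftrightarrow> i mod h = j mod h" for i j
  proof -
    have "distinct (map (head C) p)" using dist unfolding vs(2) by simp
    then have "map (head C) p ! (i mod h) = map (head C) p ! (j mod h) \<longleftrightarrow> i mod h = j mod h"
      using mod by (intro nth_eq_iff_index_eq) auto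
    then show ?thesis using mod by (simp add: head)
  qed
  have inj: "g i = g j \<longleftrightarrow> i mod h = j mod h" for i j
  proof -
    have "g k = g (Suc (k + (h - 1)))" for k using h by (simp add: g_def)
    then have "g i = g j \<longleftrightarrow> (i + (h - 1)) mod h = (j + (h - 1)) mod h" using inj_Suc by metis
    also have "\<dots> \<longleftrightarrow> i mod h = j mod h"
      using cong_add_rcancel_nat[of i "h - 1" j h] by (simp add: cong_def)
    finally show ?thesis .
  qed
  have set_p: "set p = range (\<lambda>j. p ! (j mod h))"
  proof (intro equalityI subsetI)
    fix e assume "e \<in> set p"
    then obtain j where "j < h" "e = p ! j" by (auto simp: in_set_conv_nth h_def)
    then show "e \<in> range (\<lambda>j. p ! (j mod h))" by (intro image_eqI[of _ _ j]) auto
  qed (use mod in auto)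
  have verts: "verts C = range g" unfolding V set_p image_image by (simp only: g_def[symmetric])
  have "arc_to_ends C ` set p = range (\<lambda>j. (g j, g (Suc j)))"
    unfolding set_p image_image arc_to_ends_def by (simp only: head g_def[symmetric])
  then have "arcs_ends C = {(g j, g (Suc j)) | j. True} \<union> {(g (Suc j), g j) | j. True}"
    unfolding E by auto
  with inj verts have "cycle_coords h g C" by (simp add: cycle_coords_def)
  moreover have "card (verts C) = h"
  proof -
    have "g j \<in> g ` {..<h}" for j
      using inj[of j "j mod h"] mod[of j] by (simp add: h_def image_iff) (metis lessThan_iff)
    then have "range g = g ` {..<h}" by auto
    moreover have "inj_on g {..<h}" by (auto simp: inj_on_def inj)
    ultimately show ?thesis by (simp add: verts card_image)
  qed
  ultimately show ?thesis using that h by blast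
qed

section \<open>Cycles of a chain cactus as its blocks\<close>

context
  fixes G :: "('a, 'b) pre_digraph"
  assumes chain: "chain_cactus G"
begin

interpretation graph G
  using chain by (simp add: chain_cactus_def cactus_def)

lemma cycles_of_subgraph: "C \<in> cycles_of G \<Longrightarrow> subgraph C G"
  and cycles_of_cycle_graph: "C \<in> cycles_of G \<Longrightarrow> cycle_graph C"
  by (auto simp: cycles_of_def)

lemma block_in_cycles_of: "block G B \<Longrightarrow> B \<in> cycles_of G"
  using chain by (auto simp: chain_cactus_def cycles_of_def block_def pre_digraph.max_subgraph_def)

lemma arc_in_cycle:
  assumes "e \<in> arcs G"
  obtains C where "C \<in> cycles_of G" "e \<in> arcs C"
  using arc_in_block[OF graph_axioms assms] block_in_cycles_of by blast

lemma adjacent_in_cycle: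
  assumes "u \<rightarrow>\<^bsub>G\<^esub> v"
  obtains C where "C \<in> cycles_of G" "u \<rightarrow>\<^bsub>C\<^esub> v" "u \<in> verts C" "v \<in> verts C"
proof -
  obtain e where e: "e \<in> arcs G" "tail G e = u" "head G e = v" using assms by auto
  obtain C where C: "C \<in> cycles_of G" "e \<in> arcs C" using arc_in_cycle[OF e(1)] .
  have "wf_digraph C" "tail C = tail G" "head C = head G"
    using cycles_of_subgraph[OF C(1)] by (auto simp: subgraph_def compatible_def)
  then have "u \<rightarrow>\<^bsub>C\<^esub> v" using C(2) e by (auto simp: arcs_ends_conv)
  then show ?thesis using that[OF C(1)] wf_digraph.adj_in_verts[OF \<open>wf_digraph C\<close>] by blast
qed

lemma cycle_has_adjacent:
  assumes "C \<in> cycles_of G"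
  obtains a b where "a \<rightarrow>\<^bsub>C\<^esub> b" "a \<in> verts C" "b \<in> verts C" "a \<noteq> b"
proof -
  obtain h g where h: "3 \<le> h" and g: "cycle_coords h g C"
    using cycle_graph_coords[OF cycles_of_cycle_graph[OF assms]] by metis
  have "g 0 \<noteq> g (Suc 0)" using g h by (simp add: cycle_coords_def)
  moreover have "g 0 \<rightarrow>\<^bsub>C\<^esub> g (Suc 0)" "g 0 \<in> verts C" "g (Suc 0) \<in> verts C"
    using g unfolding cycle_coords_def by blast+
  ultimately show ?thesis using that by blast
qed

text \<open>A cycle and the block through one of its edges share that edge, hence coincide in a cactus.\<close>
lemma cycle_is_block:
  assumes "C \<in> cycles_of G"
  shows "block G C"
proof -
  obtain a b where "a \<rightarrow>\<^bsub>C\<^esub> b" using cycle_has_adjacent[OF assms] .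
  then obtain e where e: "e \<in> arcs C" by auto
  then have "e \<in> arcs G" using cycles_of_subgraph[OF assms] by auto
  then obtain B where B: "block G B" "e \<in> arcs B" using arc_in_block[OF graph_axioms] by blast
  then have "B = C"
    using chain block_in_cycles_of[OF B(1)] assms e \<open>e \<in> arcs G\<close>
    unfolding chain_cactus_def cactus_def by blast
  then show ?thesis using B by simp
qed

text \<open>The nonseparable union contains every \<open>B i\<close>, and each \<open>B i\<close> is
  a block, so by maximality each of them equals the union. All later uniqueness and disjointness
  arguments draw on this; repetitions among the \<open>B i\<close> are allowed.\<close>

lemma cyclically_linked_cycles_eq:
  assumes B: "\<And>i. i \<le> m \<Longrightarrow> B i \<in> cycles_of G"
    and "\<And>i. i < m \<Longrightarrow> x i \<in> verts (B i) \<inter> verts (B (Suc i))"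
    and "x m \<in> verts (B m) \<inter> verts (B 0)" and "inj_on x {..m}" and "i \<le> m" "j \<le> m"
  shows "B i = B j"
proof -
  have block: "block G (B i)" if "i \<le> m" for i using cycle_is_block[OF B[OF that]] .
  have "subgraph (B i) G" "nonseparable (B i)" if "i \<le> m" for i
    using block[OF that] unfolding block_def pre_digraph.max_subgraph_def by blast+
  then obtain H where H: "subgraph H G" "nonseparable H" "\<And>i. i \<le> m \<Longrightarrow> subgraph (B i) H"
    using nonseparable_cyclic_union[OF wf_digraph_axioms, of m B x] assms(2-4) by metis
  have "H = B i" if "i \<le> m" for i
    using block[OF that] H that unfolding block_def pre_digraph.max_subgraph_def by blast
  then show ?thesis using assms(5,6) by metis
qed

lemma cycles_share_one_vertex:
  assumes "C \<in> cycles_of G" "D \<in> cycles_of G" "C \<noteq> D"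
    and "a \<in> verts C \<inter> verts D" "b \<in> verts C \<inter> verts D"
  shows "a = b"
proof (rule ccontr)
  assume "a \<noteq> b"
  let ?B = "\<lambda>i :: nat. if i = 0 then C else D" and ?x = "\<lambda>i :: nat. if i = 0 then a else b"
  have "?B 0 = ?B 1"
  proof (rule cyclically_linked_cycles_eq[where x = ?x and m = 1])
    show "inj_on ?x {..1}" using \<open>a \<noteq> b\<close> by (simp add: inj_on_def)
  qed (use assms in simp_all)
  with assms show False by simp
qed

lemma reachable_in_chain: "u \<in> verts G \<Longrightarrow> v \<in> verts G \<Longrightarrow> u \<rightarrow>\<^sup>*\<^bsub>G\<^esub> v"
  using chain connected_iff_reachable[OF wf_digraph_axioms sym_arcs]
  by (auto simp: chain_cactus_def cactus_def)

text \<open>Otherwise the cycles traversed by a path avoiding the shared vertex would close up.\<close>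
lemma shared_vertex_is_cut_vertex:
  assumes C: "C \<in> cycles_of G" and D: "D \<in> cycles_of G" and "C \<noteq> D"
    and v: "v \<in> verts C" "v \<in> verts D"
  shows "cut_vertex G v"
proof (rule ccontr)
  assume not_cut: "\<not> cut_vertex G v"
  let ?D = "del_vert v"
  interpret V: wf_digraph ?D by (rule wf_digraph_del_vert)
  obtain u where u: "u \<in> verts C" "u \<noteq> v" using cycle_has_adjacent[OF C] by metis
  obtain w where w: "w \<in> verts D" "w \<noteq> v" using cycle_has_adjacent[OF D] by metis
  have sub: "verts C \<subseteq> verts G" "verts D \<subseteq> verts G" using cycles_of_subgraph C D by auto
  then have "u \<rightarrow>\<^sup>*\<^bsub>G\<^esub> w" using u w by (auto intro: reachable_in_chain)
  then have "u \<rightarrow>\<^sup>*\<^bsub>?D\<^esub> w" using not_cut u w v sub unfolding cut_vertex_def by blast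
  then obtain p where p: "V.apath u p w" using V.reachable_apath by blast
  define xs where "xs = V.awalk_verts u p"
  have walk: "V.awalk u p w" and dist: "distinct xs" using p by (auto simp: V.apath_def xs_def)
  have cas: "V.cas u p w" using walk by (simp add: V.awalk_def)
  have len: "length xs = Suc (length p)" by (simp add: xs_def V.length_awalk_verts)
  have "set xs \<subseteq> verts ?D" using walk unfolding V.awalk_conv xs_def by blast
  then have xs_v: "x \<in> set xs \<Longrightarrow> x \<noteq> v" for x unfolding pre_digraph.verts_del_vert by blast
  have xs_0: "xs ! 0 = u" using V.awhd_if_cas[OF cas] len by (simp add: xs_def hd_conv_nth)
  have xs_last: "xs ! length p = w"
    using V.awlast_if_cas[OF cas] len by (simp add: xs_def last_conv_nth)
  have tail: "xs ! i = tail G (p ! i)" if "i < length p" for i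
    using that unfolding xs_def V.awalk_verts_conv
    by (auto simp: nth_append pre_digraph.del_vert_simps)
  have head: "xs ! Suc i = head G (p ! i)" if "i < length p" for i
    using that unfolding xs_def V.awalk_verts_conv'[OF cas]
    by (auto simp: pre_digraph.del_vert_simps)
  have "\<exists>K. K \<in> cycles_of G \<and> p ! i \<in> arcs K" if "i < length p" for i
  proof -
    have "set p \<subseteq> arcs G" using walk by (auto simp: V.awalk_def pre_digraph.del_vert_simps)
    then have "p ! i \<in> arcs G" using that by auto
    then show ?thesis using arc_in_cycle by blast
  qed
  then obtain K where K: "\<And>i. i < length p \<Longrightarrow> K i \<in> cycles_of G \<and> p ! i \<in> arcs (K i)" by metis
  have K_ends: "xs ! i \<in> verts (K i)" "xs ! Suc i \<in> verts (K i)" if "i < length p" for i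
  proof -
    have "wf_digraph (K i)" "tail (K i) = tail G" "head (K i) = head G"
      using cycles_of_subgraph K[OF that] by (auto simp: subgraph_def compatible_def)
    then show "xs ! i \<in> verts (K i)" "xs ! Suc i \<in> verts (K i)"
      using tail[OF that] head[OF that] K[OF that] by (metis wf_digraph.tail_in_verts wf_digraph.head_in_verts)+
  qed
  \<comment> \<open>The closed chain is \<open>C\<close>, the cycles through the successive arcs of
    the path, then \<open>D\<close>. The path vertices are the links and \<open>v\<close> closes it;
    \<open>v\<close> is new because the path avoids it. Consecutive arcs may lie on the same
    cycle.\<close>
  let ?B = "\<lambda>i. if i = 0 then C else if i \<le> length p then K (i - 1) else D"
  let ?x = "\<lambda>i. if i \<le> length p then xs ! i else v"
  have "?B 0 = ?B (Suc (length p))"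
  proof (rule cyclically_linked_cycles_eq[where x = ?x and m = "Suc (length p)"])
    show "?B i \<in> cycles_of G" for i using C D K[of "i - 1"] by auto
    show "?x i \<in> verts (?B i) \<inter> verts (?B (Suc i))" if "i < Suc (length p)" for i
    proof
      show "?x i \<in> verts (?B i)"
        using that K_ends(2)[of "i - 1"] u xs_0 by auto
      show "?x i \<in> verts (?B (Suc i))"
        using that K_ends(1)[of i] w xs_last by (cases "i = length p") auto
    qed
    show "?x (Suc (length p)) \<in> verts (?B (Suc (length p))) \<inter> verts (?B 0)" using v by simp
    show "inj_on ?x {..Suc (length p)}"
    proof (rule inj_onI)
      fix i j assume *: "i \<in> {..Suc (length p)}" "j \<in> {..Suc (length p)}" "?x i = ?x j"
      have "xs ! i \<noteq> v" if "i \<le> length p" for i using xs_v[of "xs ! i"] len that by simp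
      with * show "i = j"
        using nth_eq_iff_index_eq[OF dist, of i j] len by (auto split: if_splits simp: le_Suc_eq)
    qed
  qed simp_all
  then show False using \<open>C \<noteq> D\<close> by simp
qed

lemma no_three_cycles_at_vertex:
  assumes "C \<in> cycles_of G" "D \<in> cycles_of G" "K \<in> cycles_of G"
    and "v \<in> verts C" "v \<in> verts D" "v \<in> verts K" "C \<noteq> D"
  shows "K = C \<or> K = D"
proof (rule ccontr)
  assume "\<not> ?thesis"
  then have "card {C, D, K} = 3" using assms by auto
  moreover have two: "card {C \<in> cycles_of G. v \<in> verts C} = 2"
    using shared_vertex_is_cut_vertex[of C D v] assms chain unfolding chain_cactus_def by blast
  moreover have "card {C, D, K} \<le> card {C \<in> cycles_of G. v \<in> verts C}"
    using assms two by (intro card_mono) (auto intro: card_ge_0_finite)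
  ultimately show False by simp
qed

lemma no_three_cut_vertices_on_cycle:
  assumes "C \<in> cycles_of G" "a \<in> verts C" "b \<in> verts C" "c \<in> verts C"
    and "cut_vertex G a" "cut_vertex G b" "cut_vertex G c" "a \<noteq> b"
  shows "c = a \<or> c = b"
proof (rule ccontr)
  assume "\<not> ?thesis"
  then have "card {a, b, c} = 3" using assms by auto
  moreover have "card {v \<in> verts C. cut_vertex G v} \<le> 2"
    using chain cycle_is_block[OF assms(1)] unfolding chain_cactus_def by blast
  moreover have "card {a, b, c} \<le> card {v \<in> verts C. cut_vertex G v}"
    using assms cycles_of_subgraph[of C] finite_subset[OF _ finite_verts]
    by (intro card_mono) auto
  ultimately show False by simp
qed

end

section \<open>The linear order of the cycles\<close>

text \<open>A partial form of \<open>chain_order\<close>: some cycles may be missing and neighbours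
  only have to meet, so that a list can be prolonged one cycle at a time.\<close>

definition linked_cycles :: "('a, 'b) pre_digraph \<Rightarrow> ('a, 'b) pre_digraph list \<Rightarrow> bool" where
  "linked_cycles G Cs \<longleftrightarrow> distinct Cs \<and> set Cs \<subseteq> cycles_of G \<and>
     (\<forall>i. Suc i < length Cs \<longrightarrow> verts (Cs ! i) \<inter> verts (Cs ! Suc i) \<noteq> {})"

context
  fixes G :: "('a, 'b) pre_digraph"
  assumes chain: "chain_cactus G"
begin

lemma linked_cycles_nth:
  assumes "linked_cycles G Cs" "i < length Cs"
  shows "Cs ! i \<in> cycles_of G"
  using assms by (auto simp: linked_cycles_def)

lemma linked_cycles_nth_eq:
  assumes "linked_cycles G Cs" "i < length Cs" "j < length Cs"
  shows "Cs ! i = Cs ! j \<longleftrightarrow> i = j"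
  using assms by (simp add: linked_cycles_def nth_eq_iff_index_eq)

lemma linked_cycles_link:
  assumes "linked_cycles G Cs" "Suc i < length Cs"
  obtains a where "a \<in> verts (Cs ! i)" "a \<in> verts (Cs ! Suc i)" "cut_vertex G a"
proof -
  obtain a where a: "a \<in> verts (Cs ! i)" "a \<in> verts (Cs ! Suc i)"
    using assms by (fastforce simp: linked_cycles_def)
  moreover have "cut_vertex G a"
    using shared_vertex_is_cut_vertex[OF chain _ _ _ a] linked_cycles_nth[OF assms(1)]
      linked_cycles_nth_eq[OF assms(1), of i "Suc i"] assms(2) by simp
  ultimately show ?thesis using that by blast
qed

lemma linked_cycles_Cons:
  assumes "linked_cycles G (C # Cs)" "D \<in> cycles_of G" "D \<notin> set (C # Cs)" "verts D \<inter> verts C \<noteq> {}"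
  shows "linked_cycles G (D # C # Cs)"
  unfolding linked_cycles_def
proof (intro conjI allI impI)
  fix i assume "Suc i < length (D # C # Cs)"
  then show "verts ((D # C # Cs) ! i) \<inter> verts ((D # C # Cs) ! Suc i) \<noteq> {}"
    using assms(1,4) by (cases i) (simp_all add: linked_cycles_def)
qed (use assms in \<open>auto simp: linked_cycles_def\<close>)

lemma linked_cycles_snoc:
  assumes "linked_cycles G Cs" "Cs \<noteq> []" "D \<in> cycles_of G" "D \<notin> set Cs" "verts (last Cs) \<inter> verts D \<noteq> {}"
  shows "linked_cycles G (Cs @ [D])"
  unfolding linked_cycles_def
proof (intro conjI allI impI)
  fix i assume "Suc i < length (Cs @ [D])"
  then consider "Suc i < length Cs" | "Suc i = length Cs" by fastforce
  then show "verts ((Cs @ [D]) ! i) \<inter> verts ((Cs @ [D]) ! Suc i) \<noteq> {}"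
  proof cases
    case 1
    then show ?thesis using assms(1) by (simp add: linked_cycles_def nth_append)
  next
    case 2
    then have "last Cs = Cs ! i" using assms(2) by (metis diff_Suc_1 last_conv_nth)
    then show ?thesis using assms(5) 2 by (simp add: nth_append)
  qed
qed (use assms in \<open>auto simp: linked_cycles_def\<close>)

text \<open>The links to the predecessor and the successor are different, since no vertex lies on
  three cycles, and they exhaust the two cut vertices allowed on \<open>Cs ! i\<close>. The shared
  vertex \<open>s\<close> is a cut vertex, hence one of them, and each already lies on two
  cycles.\<close>

lemma internal_link_vertices:
  assumes Cs: "linked_cycles G Cs" and i: "0 < i" "Suc i < length Cs"
    and D: "D \<in> cycles_of G" "D \<noteq> Cs ! i" "s \<in> verts (Cs ! i)" "s \<in> verts D"
  shows "D = Cs ! (i - 1) \<or> D = Cs ! Suc i"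
proof (rule ccontr)
  assume not: "\<not> ?thesis"
  have cyc: "Cs ! (i - 1) \<in> cycles_of G" "Cs ! i \<in> cycles_of G" "Cs ! Suc i \<in> cycles_of G"
    using linked_cycles_nth[OF Cs] i by simp_all
  have neq: "Cs ! (i - 1) \<noteq> Cs ! i" "Cs ! i \<noteq> Cs ! Suc i" "Cs ! (i - 1) \<noteq> Cs ! Suc i"
    using linked_cycles_nth_eq[OF Cs] i by simp_all
  obtain a where a: "a \<in> verts (Cs ! (i - 1))" "a \<in> verts (Cs ! i)" "cut_vertex G a"
    using linked_cycles_link[OF Cs, of "i - 1"] i by auto
  obtain b where b: "b \<in> verts (Cs ! i)" "b \<in> verts (Cs ! Suc i)" "cut_vertex G b"
    using linked_cycles_link[OF Cs i(2)] by blast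
  have s: "cut_vertex G s" using shared_vertex_is_cut_vertex[OF chain D(1) cyc(2) D(2) D(4,3)] .
  have "a \<noteq> b" using no_three_cycles_at_vertex[OF chain cyc(1,2,3) a(1,2)] b neq by auto
  then have "s = a \<or> s = b"
    using no_three_cut_vertices_on_cycle[OF chain cyc(2) a(2) b(1) D(3) a(3) b(3) s] by simp
  then show False
    using no_three_cycles_at_vertex[OF chain cyc(1,2) D(1) a(1,2)]
      no_three_cycles_at_vertex[OF chain cyc(2,3) D(1) b(1,2)] neq D not by auto
qed

text \<open>A longest linked list cannot be prolonged at its ends, and its internal cycles have no
  neighbours outside it. A cycle meeting a member is thus a member, and by connectedness membership
  spreads to all cycles.\<close>

lemma linked_cycles_all:
  assumes fin: "finite (cycles_of G)" and ne: "cycles_of G \<noteq> {}"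
  obtains Cs where "linked_cycles G Cs" "set Cs = cycles_of G"
proof -
  obtain C where "C \<in> cycles_of G" using ne by blast
  then have C: "linked_cycles G [C]" by (simp add: linked_cycles_def)
  have "length Cs \<le> card (cycles_of G)" if "linked_cycles G Cs" for Cs
    using that card_mono[OF fin, of "set Cs"] by (simp add: linked_cycles_def distinct_card)
  then have "\<exists>Cs. linked_cycles G Cs \<and> (\<forall>Ds. linked_cycles G Ds \<longrightarrow> length Ds \<le> length Cs)"
    by (intro ex_has_greatest_nat[of _ "[C]" _ "Suc (card (cycles_of G))"])
      (use C in \<open>simp_all add: less_Suc_eq_le\<close>)
  then obtain Cs where Cs: "linked_cycles G Cs"
    and max: "\<And>Ds. linked_cycles G Ds \<Longrightarrow> length Ds \<le> length Cs" by metis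
  have Cs_ne: "Cs \<noteq> []" using max[OF C] by auto
  then have len: "0 < length Cs" by simp
  have no_neighbour: False
    if D: "D \<in> cycles_of G" "D \<notin> set Cs" and s: "K \<in> set Cs" "s \<in> verts K" "s \<in> verts D" for D K s
  proof -
    obtain i where i: "i < length Cs" "K = Cs ! i" using s(1) by (metis in_set_conv_nth)
    consider "i = 0" | "Suc i = length Cs" | "0 < i" "Suc i < length Cs" using i by linarith
    then show False
    proof cases
      case 1
      obtain C' Cs' where eq: "Cs = C' # Cs'" using Cs_ne by (cases Cs) auto
      have "linked_cycles G (D # C' # Cs')"
        using Cs D s i 1 unfolding eq by (intro linked_cycles_Cons) auto
      then show False using max eq by fastforce
    next
      case 2
      then have "last Cs = K" using i Cs_ne by (metis diff_Suc_1 last_conv_nth)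
      then have "linked_cycles G (Cs @ [D])"
        using s by (intro linked_cycles_snoc[OF Cs Cs_ne D]) blast
      then show False using max by fastforce
    next
      case 3
      then have "D = Cs ! (i - 1) \<or> D = Cs ! Suc i"
        using D s i by (intro internal_link_vertices[OF Cs 3 D(1), of s]) auto
      then show False using D 3 by auto
    qed
  qed
  have "D \<in> set Cs" if D: "D \<in> cycles_of G" for D
  proof (rule ccontr)
    assume notin: "D \<notin> set Cs"
    have "Cs ! 0 \<in> cycles_of G" using linked_cycles_nth[OF Cs] len .
    then obtain a where a: "a \<in> verts (Cs ! 0)" using cycle_has_adjacent[OF chain] by metis
    obtain b where b: "b \<in> verts D" using cycle_has_adjacent[OF chain D] by metis
    have "a \<in> verts G" "b \<in> verts G"
      using a b cycles_of_subgraph[OF chain] D \<open>Cs ! 0 \<in> cycles_of G\<close> by (auto simp: subgraph_def)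
    then have reach: "a \<rightarrow>\<^sup>*\<^bsub>G\<^esub> b" by (rule reachable_in_chain[OF chain])
    interpret wf_digraph G
      using chain by (simp add: chain_cactus_def cactus_def graph_def digraph_def fin_digraph_def)
    from reach have "\<exists>K\<in>set Cs. b \<in> verts K"
    proof (induction rule: reachable_induct)
      case base
      then show ?case using a len by (meson nth_mem)
    next
      case (step x y)
      obtain K where K: "K \<in> cycles_of G" "x \<in> verts K" "y \<in> verts K"
        using adjacent_in_cycle[OF chain step(2)] by metis
      then show ?case using no_neighbour step.IH by blast
    qed
    then show False using no_neighbour[OF D notin] b by blast
  qed
  then have "set Cs = cycles_of G" using Cs by (auto simp: linked_cycles_def)
  then show ?thesis using that Cs by blast
qed

text \<open>A common vertex \<open>s\<close> cannot lie on an internal cycle of the list, which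
  leaves only the first and the last cycle. Then \<open>s\<close> closes the whole list cyclically.
  The links are distinct because no vertex lies on three cycles, so the cycles would all
  coincide.\<close>

lemma linked_cycles_disjoint:
  assumes Cs: "linked_cycles G Cs" and ij: "Suc i < j" "j < length Cs"
  shows "verts (Cs ! i) \<inter> verts (Cs ! j) = {}"
proof (rule ccontr)
  assume "\<not> ?thesis"
  then obtain s where s: "s \<in> verts (Cs ! i)" "s \<in> verts (Cs ! j)" by blast
  have ne: "Cs \<noteq> []" using ij by auto
  note cyc = linked_cycles_nth[OF Cs] and eq = linked_cycles_nth_eq[OF Cs]
  have i0: "i = 0"
  proof (rule ccontr)
    assume "i \<noteq> 0"
    then have "Cs ! j = Cs ! (i - 1) \<or> Cs ! j = Cs ! Suc i"
      using ij s cyc eq by (intro internal_link_vertices[OF Cs, of i _ s]) auto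
    then show False using eq ij by auto
  qed
  have jl: "Suc j = length Cs"
  proof (rule ccontr)
    assume "Suc j \<noteq> length Cs"
    then have "Cs ! i = Cs ! (j - 1) \<or> Cs ! i = Cs ! Suc j"
      using ij s cyc eq by (intro internal_link_vertices[OF Cs, of j _ s]) auto
    then show False using eq[of i "j - 1"] eq[of i "Suc j"] ij \<open>Suc j \<noteq> length Cs\<close> by auto
  qed
  have "\<exists>a. a \<in> verts (Cs ! k) \<and> a \<in> verts (Cs ! Suc k)" if "k < j" for k
    using linked_cycles_link[OF Cs, of k] that ij by (metis Suc_lessI less_trans_Suc)
  then obtain a where a: "\<And>k. k < j \<Longrightarrow> a k \<in> verts (Cs ! k) \<and> a k \<in> verts (Cs ! Suc k)" by metis
  have three: "p = q \<or> p = r \<or> q = r"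
    if "p < length Cs" "q < length Cs" "r < length Cs"
      "v \<in> verts (Cs ! p)" "v \<in> verts (Cs ! q)" "v \<in> verts (Cs ! r)" for p q r v
    using no_three_cycles_at_vertex[OF chain cyc cyc cyc, OF that(1-3) that(4-6)] that eq by metis
  have a_s: "a k \<noteq> s" if "k < j" for k
  proof
    assume "a k = s"
    then have *: "s \<in> verts (Cs ! k)" "s \<in> verts (Cs ! Suc k)" using a[OF that] by auto
    show False
    proof (cases "k = 0")
      case True
      then show False using three[of 0 1 j s] * s i0 ij ne by simp
    next
      case False
      then show False using three[of 0 k j s] * s i0 ij that ne by simp
    qed
  qed
  have a_inj: "a k \<noteq> a l" if "k < l" "l < j" for k l
  proof
    assume "a k = a l"
    then have "a l \<in> verts (Cs ! k)" "a l \<in> verts (Cs ! l)" "a l \<in> verts (Cs ! Suc l)"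
      using a[of k] a[of l] that by auto
    then show False using three[of k l "Suc l" "a l"] that ij by simp
  qed
  have "Cs ! 0 = Cs ! j"
  proof (rule cyclically_linked_cycles_eq[OF chain, where x = "\<lambda>k. if k < j then a k else s" and m = j])
    show "Cs ! k \<in> cycles_of G" if "k \<le> j" for k using cyc[of k] that ij by simp
    show "inj_on (\<lambda>k. if k < j then a k else s) {..j}"
    proof (rule inj_onI)
      fix k l assume *: "k \<in> {..j}" "l \<in> {..j}" "(if k < j then a k else s) = (if l < j then a l else s)"
      show "k = l"
        using * a_s[of k] a_s[of l] a_inj[of k l] a_inj[of l k] by (cases k l rule: linorder_cases) (auto split: if_splits)
    qed
  qed (use a s i0 in auto)
  then show False using eq[of 0 j] ij ne by simp
qed

lemma linked_cycles_chain_order: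
  assumes Cs: "linked_cycles G Cs" "set Cs = cycles_of G"
  shows "chain_order G Cs"
  unfolding chain_order_def
proof (intro conjI allI impI)
  fix i assume i: "Suc i < length Cs"
  obtain a where a: "a \<in> verts (Cs ! i)" "a \<in> verts (Cs ! Suc i)" "cut_vertex G a"
    using linked_cycles_link[OF Cs(1) i] .
  have "Cs ! i \<in> cycles_of G" "Cs ! Suc i \<in> cycles_of G" "Cs ! i \<noteq> Cs ! Suc i"
    using linked_cycles_nth[OF Cs(1)] linked_cycles_nth_eq[OF Cs(1)] i by simp_all
  then have "b = a" if "b \<in> verts (Cs ! i) \<inter> verts (Cs ! Suc i)" for b
    using cycles_share_one_vertex[OF chain] that a by blast
  then have "verts (Cs ! i) \<inter> verts (Cs ! Suc i) = {a}" using a by blast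
  with a show "\<exists>v. cut_vertex G v \<and> verts (Cs ! i) \<inter> verts (Cs ! Suc i) = {v}" by blast
qed (use Cs in \<open>auto simp: linked_cycles_def\<close>)

end

section \<open>Coordinates on a chain cactus\<close>

lemma cycle_coords_eq_iff: "cycle_coords h g C \<Longrightarrow> g i = g j \<longleftrightarrow> i mod h = j mod h"
  by (simp add: cycle_coords_def)

lemma cycle_coords_alt:
  "cycle_coords h g C \<longleftrightarrow>
     (\<forall>i j. g i = g j \<longleftrightarrow> i mod h = j mod h) \<and> verts C = range g \<and>
     arcs_ends C = range (\<lambda>j. (g j, g (Suc j))) \<union> (range (\<lambda>j. (g j, g (Suc j))))\<inverse>"
proof -
  have "{(g j, g (Suc j)) | j. True} \<union> {(g (Suc j), g j) | j. True}
    = range (\<lambda>j. (g j, g (Suc j))) \<union> (range (\<lambda>j. (g j, g (Suc j))))\<inverse>"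
    by auto
  then show ?thesis by (simp only: cycle_coords_def)
qed

lemma cycle_coords_shift:
  assumes C: "cycle_coords h g C" and h: "0 < h"
  shows "cycle_coords h (\<lambda>j. g (j + s)) C"
proof -
  \<comment> \<open>Adding \<open>(h - 1) * s\<close> undoes a shift by \<open>s\<close> modulo
    \<open>h\<close> without subtraction on natural numbers.\<close>
  have wrap: "g ((j + (h - 1) * s) + s) = g j" "g (Suc (j + (h - 1) * s) + s) = g (Suc j)" for j
  proof -
    have "(h - 1) * s + s = h * s" using h by (cases h) auto
    then have "(j + (h - 1) * s) + s = j + h * s" "Suc (j + (h - 1) * s) + s = Suc j + h * s" by simp_all
    then show "g ((j + (h - 1) * s) + s) = g j" "g (Suc (j + (h - 1) * s) + s) = g (Suc j)"
      unfolding cycle_coords_eq_iff[OF C] by (metis mod_mult_self2)+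
  qed
  have "range g = range (\<lambda>j. g (j + s))"
  proof (intro equalityI subsetI)
    fix x assume "x \<in> range g"
    then obtain j where "x = g j" by blast
    then show "x \<in> range (\<lambda>j. g (j + s))" using wrap(1)[of j]
      by (intro image_eqI[where x = "j + (h - 1) * s"]) simp_all
  qed auto
  moreover have "range (\<lambda>j. (g j, g (Suc j))) = range (\<lambda>j. (g (j + s), g (Suc j + s)))"
  proof (intro equalityI subsetI)
    fix x assume "x \<in> range (\<lambda>j. (g j, g (Suc j)))"
    then obtain j where "x = (g j, g (Suc j))" by blast
    then show "x \<in> range (\<lambda>j. (g (j + s), g (Suc j + s)))"
      using wrap[of j] by (intro image_eqI[where x = "j + (h - 1) * s"]) (simp_all only: UNIV_I)
  qed auto
  moreover have "(i + s) mod h = (j + s) mod h \<longleftrightarrow> i mod h = j mod h" for i j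
    using cong_add_rcancel_nat[of i s j h] by (simp add: cong_def)
  ultimately show ?thesis using C unfolding cycle_coords_alt by simp
qed

text \<open>Multiplication by \<open>h - 1\<close> is negation modulo \<open>h\<close>.\<close>
lemma mult_pred_mod:
  assumes "0 < (h :: nat)"
  shows "(a + b * (h - 1)) mod h = c mod h \<longleftrightarrow> a mod h = (b + c) mod h"
proof -
  have "a + b * (h - 1) + b = a + b * h" using assms by (cases h) auto
  then have "(a + b * (h - 1) + b) mod h = a mod h" by (metis mod_mult_self1)
  then show ?thesis using cong_add_rcancel_nat[of "a + b * (h - 1)" b c h]
    by (simp add: cong_def add.commute)
qed

text \<open>Reversing the orientation exchanges an offset \<open>r\<close> with
  \<open>h - r\<close>, which is how an offset is brought to at most half of \<open>h\<close>. Each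
  edge is listed in the opposite direction, so the two halves of \<open>arcs_ends\<close> are
  swapped.\<close>

lemma cycle_coords_reflect:
  assumes C: "cycle_coords h g C" and h: "0 < h"
  shows "cycle_coords h (\<lambda>j. g (j * (h - 1))) C"
proof -
  let ?f = "\<lambda>j. g (j * (h - 1))"
  have inj: "?f i = ?f j \<longleftrightarrow> i mod h = j mod h" for i j
    unfolding cycle_coords_eq_iff[OF C] using mult_pred_mod[OF h, of 0 i "j * (h - 1)"]
      mult_pred_mod[OF h, of i j 0] by (auto simp: add.commute)
  have involution: "?f (j * (h - 1)) = g j" for j
  proof -
    have "j * (h - 1) + j = j * h" using h by (cases h) auto
    then show ?thesis
      unfolding cycle_coords_eq_iff[OF C] using mult_pred_mod[OF h, of 0 "j * (h - 1)" j] by simp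
  qed
  have Suc_f: "?f j = g (Suc (Suc j * (h - 1)))" for j
  proof -
    have "Suc (Suc j * (h - 1)) = j * (h - 1) + h" using h by (cases h) auto
    then show ?thesis unfolding cycle_coords_eq_iff[OF C] by simp
  qed
  have edge: "\<exists>j. g t = ?f (Suc j) \<and> g (Suc t) = ?f j" for t
  proof -
    let ?j = "t * (h - 1) + (h - 1)"
    have "Suc ?j = t * (h - 1) + h" using h by simp
    then have f: "?f (Suc ?j) = ?f (t * (h - 1))" unfolding inj by simp
    then have "g t = g (Suc ?j * (h - 1))" using involution by simp
    then have "g (Suc t) = g (Suc (Suc ?j * (h - 1)))"
      unfolding cycle_coords_eq_iff[OF C] by (metis mod_Suc_eq)
    then show ?thesis using f involution Suc_f by metis
  qed
  have "range g = range ?f"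
  proof (intro equalityI subsetI)
    fix x assume "x \<in> range g"
    then obtain j where "x = g j" by blast
    then show "x \<in> range ?f" using involution[of j] by (intro image_eqI[where x = "j * (h - 1)"]) auto
  qed auto
  moreover have "range (\<lambda>j. (g j, g (Suc j))) = (range (\<lambda>j. (?f j, ?f (Suc j))))\<inverse>"
  proof (intro equalityI subsetI)
    fix x assume "x \<in> range (\<lambda>j. (g j, g (Suc j)))"
    then obtain t where x: "x = (g t, g (Suc t))" by blast
    obtain j where "g t = ?f (Suc j)" "g (Suc t) = ?f j" using edge[of t] by blast
    then have "(g (Suc t), g t) \<in> range (\<lambda>j. (?f j, ?f (Suc j)))"
      by (intro image_eqI[where x = j]) (simp_all only: UNIV_I)
    then show "x \<in> (range (\<lambda>j. (?f j, ?f (Suc j))))\<inverse>" unfolding x by (rule converseI)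
  next
    fix x assume "x \<in> (range (\<lambda>j. (?f j, ?f (Suc j))))\<inverse>"
    then obtain j where x: "x = (?f (Suc j), ?f j)" by blast
    show "x \<in> range (\<lambda>j. (g j, g (Suc j)))"
      unfolding x Suc_f[of j] by (rule range_eqI) (rule refl)
  qed
  ultimately show ?thesis using C inj unfolding cycle_coords_alt by (simp add: Un_commute)
qed

text \<open>The index \<open>a\<close> is arbitrary because a linking vertex is placed at index 1 in
  the first cycle of a chain and at index 0 in the later ones.\<close>

lemma cycle_coords_start:
  assumes C: "cycle_coords h g C" and h: "0 < h" and y: "y \<in> verts C"
  obtains g' where "cycle_coords h g' C" "g' a = y"
proof -
  obtain r where r: "y = g r" using C y by (auto simp: cycle_coords_def)
  have "a + (r + a * (h - 1)) = r + a * h" using h by (cases h) auto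
  then have "g (a + (r + a * (h - 1))) = y" unfolding r cycle_coords_eq_iff[OF C] by (metis mod_mult_self1)
  then show ?thesis using that[OF cycle_coords_shift[OF C h, of "r + a * (h - 1)"]] by simp
qed

lemma cycle_coords_position:
  assumes C: "cycle_coords h g C" and h: "0 < h" and xy: "x \<in> verts C" "y \<in> verts C" "x \<noteq> y"
  obtains g' d where "cycle_coords h g' C" "g' 0 = x" "g' d = y" "0 < d" "2 * d \<le> h"
proof -
  obtain f where f: "cycle_coords h f C" "f 0 = x" using cycle_coords_start[OF C h xy(1)] .
  obtain r' where "y = f r'" using f xy by (auto simp: cycle_coords_def)
  then have r: "y = f (r' mod h)" using cycle_coords_eq_iff[OF f(1)] by simp
  define r where "r = r' mod h"
  have y: "y = f r" and rh: "r < h" using r h by (auto simp: r_def)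
  have r0: "r \<noteq> 0" using y f(2) xy(3) by metis
  show ?thesis
  proof (cases "2 * r \<le> h")
    case True
    then show ?thesis using that[OF f _ _ True] y r0 by simp
  next
    case False
    have "f ((h - r) * (h - 1)) = f r"
      unfolding cycle_coords_eq_iff[OF f(1)]
      using mult_pred_mod[OF h, of 0 "h - r" r] rh by simp
    then show ?thesis
      using that[OF cycle_coords_reflect[OF f(1) h], of "h - r"] f(2) y r0 rh False by simp
  qed
qed

text \<open>Each arc changes the index by 1 or -1 modulo \<open>h\<close>, so the net change, an
  integer, is bounded by the number of arcs.\<close>

lemma cycle_coords_walk_offset:
  assumes C: "cycle_coords h g C" and wf: "wf_digraph C"
    and walk: "pre_digraph.awalk C (g a) p (g b)"
  shows "\<exists>t. \<bar>t\<bar> \<le> int (length p) \<and> (int a + t) mod int h = int b mod int h"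
  using walk
proof (induction p arbitrary: a)
  case Nil
  then have "g a = g b" using wf_digraph.awalk_Nil_iff[OF wf] by metis
  then have "int (a mod h) = int (b mod h)" by (simp add: cycle_coords_eq_iff[OF C])
  then show ?case by (intro exI[of _ 0]) (simp add: zmod_int)
next
  case (Cons e p)
  then have e: "e \<in> arcs C" "tail C e = g a" and p: "pre_digraph.awalk C (head C e) p (g b)"
    using wf_digraph.awalk_Cons_iff[OF wf] by metis+
  have "(g a, head C e) \<in> arcs_ends C" using e by (force simp: arcs_ends_conv)
  then obtain j where "g a = g j \<and> head C e = g (Suc j) \<or> g a = g (Suc j) \<and> head C e = g j"
    using C unfolding cycle_coords_def by auto
  then show ?case
  proof
    assume j: "g a = g j \<and> head C e = g (Suc j)"
    obtain t where t: "\<bar>t\<bar> \<le> int (length p)" "(int (Suc j) + t) mod int h = int b mod int h"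
      using Cons.IH[of "Suc j"] p j by auto
    have "int (a mod h) = int (j mod h)" using j by (simp add: cycle_coords_eq_iff[OF C])
    then have "int a mod int h = int j mod int h" by (simp add: zmod_int)
    then have "(int a + (t + 1)) mod int h = (int j + (t + 1)) mod int h" by (metis mod_add_left_eq)
    also have "\<dots> = int b mod int h" using t(2) by (simp add: algebra_simps)
    finally show ?thesis using t(1) by (intro exI[of _ "t + 1"]) auto
  next
    assume j: "g a = g (Suc j) \<and> head C e = g j"
    obtain t where t: "\<bar>t\<bar> \<le> int (length p)" "(int j + t) mod int h = int b mod int h"
      using Cons.IH[of j] p j by auto
    have "int (a mod h) = int (Suc j mod h)" using j by (simp add: cycle_coords_eq_iff[OF C])
    then have "int a mod int h = int (Suc j) mod int h" by (simp add: zmod_int)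
    then have "(int a + (t - 1)) mod int h = (int (Suc j) + (t - 1)) mod int h" by (metis mod_add_left_eq)
    also have "\<dots> = int b mod int h" using t(2) by (simp add: algebra_simps)
    finally show ?thesis using t(1) by (intro exI[of _ "t - 1"]) auto
  qed
qed

lemma cycle_coords_walk:
  assumes C: "cycle_coords h g C" and wf: "wf_digraph C"
  shows "\<exists>p. pre_digraph.awalk C (g a) p (g (a + d)) \<and> length p = d"
proof (induction d)
  case 0
  have "g a \<in> verts C" using C by (simp add: cycle_coords_def)
  then have "pre_digraph.awalk C (g a) [] (g (a + 0))" using wf_digraph.awalk_Nil_iff[OF wf] by simp
  then show ?case by (intro exI[of _ "[]"]) simp
next
  case (Suc d)
  then obtain p where p: "pre_digraph.awalk C (g a) p (g (a + d))" "length p = d" by blast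
  have "(g (a + d), g (Suc (a + d))) \<in> arcs_ends C" using C unfolding cycle_coords_def by blast
  then obtain e where "e \<in> arcs C" "tail C e = g (a + d)" "head C e = g (Suc (a + d))" by blast
  then have "pre_digraph.awalk C (g (a + d)) [e] (g (Suc (a + d)))"
    using wf_digraph.arc_implies_awalk[OF wf] by metis
  then show ?case using wf_digraph.awalk_appendI[OF wf p(1)] p(2)
    by (intro exI[of _ "p @ [e]"]) simp
qed

text \<open>A shorter walk would have a net change \<open>t\<close> congruent to \<open>d\<close>
  modulo \<open>h\<close>, but \<open>0 < d - t < 2 * d <= h\<close> leaves no room for that. The
  walk along the numbering attains \<open>d\<close>.\<close>

lemma cycle_coords_distance:
  assumes C: "cycle_coords h g C" and wf: "wf_digraph C" and d: "0 < d" "2 * d \<le> h"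
  shows "wf_digraph.\<mu> C (\<lambda>_. 1) (g a) (g (a + d)) = ereal (real d)"
proof -
  interpret wf_digraph C by (rule wf)
  have cost: "awalk_cost (\<lambda>_. 1) p = real (length p)" for p by (induction p) simp_all
  show ?thesis
  proof (rule antisym)
    obtain p where "awalk (g a) p (g (a + d))" "length p = d" using cycle_coords_walk[OF C wf] by blast
    then show "\<mu> (\<lambda>_. 1) (g a) (g (a + d)) \<le> ereal (real d)"
      using min_cost_le_walk_cost[of "g a" p "g (a + d)" "\<lambda>_. 1"] by (simp add: cost)
    have "d \<le> length p" if p: "awalk (g a) p (g (a + d))" for p
    proof (rule ccontr)
      assume less: "\<not> d \<le> length p"
      obtain t where t: "\<bar>t\<bar> \<le> int (length p)" "(int a + t) mod int h = int (a + d) mod int h"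
        using cycle_coords_walk_offset[OF C wf p] by blast
      then have "int h dvd (int (a + d) - (int a + t))" by (metis mod_eq_dvd_iff)
      then have "int h dvd (int d - t)" by (simp add: algebra_simps)
      moreover have "0 < int d - t" "int d - t < int h" using t(1) less d by auto
      ultimately show False using zdvd_not_zless by blast
    qed
    then show "ereal (real d) \<le> \<mu> (\<lambda>_. 1) (g a) (g (a + d))"
      unfolding \<mu>_def by (intro INF_greatest) (simp add: cost)
  qed
qed

text \<open>\<open>in_position\<close> does not say which cut vertex comes first, so the backward
  distance is needed too. Shifting by \<open>d\<close> and reflecting turns it into the forward
  one.\<close>

lemma cycle_coords_distance':
  assumes C: "cycle_coords h g C" and wf: "wf_digraph C" and d: "0 < d" "2 * d \<le> h"
  shows "wf_digraph.\<mu> C (\<lambda>_. 1) (g d) (g 0) = ereal (real d)"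
proof -
  have h: "0 < h" using d by simp
  let ?f = "\<lambda>j. g (j * (h - 1) + d)"
  have f: "cycle_coords h ?f C"
    using cycle_coords_reflect[OF cycle_coords_shift[OF C h] h] .
  have "d * (h - 1) + d = d * h" using h by (cases h) auto
  then have "?f d = g 0" unfolding cycle_coords_eq_iff[OF C] by simp
  then show ?thesis using cycle_coords_distance[OF f wf d, of 0] by simp
qed

lemma in_position_unique:
  assumes C: "cycle_coords h g C" and wf: "wf_digraph C" and d: "0 < d" "2 * d \<le> h"
    and cut: "{w \<in> verts C. cut_vertex G w} = {g 0, g d}" and pos: "in_position G C k"
  shows "d = k"
proof -
  obtain u v where uv: "u \<noteq> v" "{w \<in> verts C. cut_vertex G w} = {u, v}"
    and \<mu>: "wf_digraph.\<mu> C (\<lambda>_. 1) u v = ereal (real k)"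
    using pos unfolding in_position_def by blast
  then have "u = g 0 \<and> v = g d \<or> u = g d \<and> v = g 0" unfolding cut by (auto simp: doubleton_eq_iff)
  then have "ereal (real k) = ereal (real d)"
    using \<mu> cycle_coords_distance[OF C wf d, of 0] cycle_coords_distance'[OF C wf d] by auto
  then show ?thesis by simp
qed

text \<open>The values 1 at both ends are the convention for cycles with only one linking vertex.
  The last conclusion serves ortho- and meta-chains alike: its hypothesis concerns all internal
  cycles, hence also those of the particular order constructed here.\<close>

lemma chain_h_cactus_coords:
  assumes G: "chain_h_cactus h n G" and n: "2 \<le> n" and h: "3 \<le> h"
  obtains d F where "chain_coords h n d F G" "d 0 = 1" "d (n - 1) = 1" "\<And>i. i < n \<Longrightarrow> 2 * d i \<le> h"
    "\<And>i k. 0 < i \<Longrightarrow> Suc i < n \<Longrightarrow> (\<And>C. internal_cycle G C \<Longrightarrow> in_position G C k) \<Longrightarrow> d i = k"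
proof -
  have chain: "chain_cactus G" and card: "card (cycles_of G) = n"
    and size: "\<And>C. C \<in> cycles_of G \<Longrightarrow> card (verts C) = h"
    using G by (auto simp: chain_h_cactus_def)
  interpret graph G using chain by (simp add: chain_cactus_def cactus_def)
  have "finite (cycles_of G)" "cycles_of G \<noteq> {}" using card n by (auto intro: card_ge_0_finite)
  then obtain Cs where Cs: "linked_cycles G Cs" and set_Cs: "set Cs = cycles_of G"
    using linked_cycles_all[OF chain] by blast
  have len: "length Cs = n" using Cs set_Cs card by (metis distinct_card linked_cycles_def)
  have cyc: "Cs ! i \<in> cycles_of G" if "i < n" for i
    using linked_cycles_nth[OF chain Cs] that len by simp
  have eq: "Cs ! i = Cs ! j \<longleftrightarrow> i = j" if "i < n" "j < n" for i j
    using linked_cycles_nth_eq[OF chain Cs] that len by simp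
  have wf: "wf_digraph (Cs ! i)" if "i < n" for i
    using cycles_of_subgraph[OF chain cyc[OF that]] by auto
  have "\<exists>v. v \<in> verts (Cs ! i) \<and> v \<in> verts (Cs ! Suc i) \<and> cut_vertex G v" if "Suc i < n" for i
    using linked_cycles_link[OF chain Cs, of i] that len by metis
  then obtain v where v: "\<And>i. Suc i < n \<Longrightarrow>
      v i \<in> verts (Cs ! i) \<and> v i \<in> verts (Cs ! Suc i) \<and> cut_vertex G (v i)" by metis
  have shared: "x = v i" if "Suc i < n" "x \<in> verts (Cs ! i)" "x \<in> verts (Cs ! Suc i)" for i x
    using cycles_share_one_vertex[OF chain cyc cyc, of i "Suc i" x "v i"] v[OF that(1)] that
      eq[of i "Suc i"] by auto
  have v_neq: "v i \<noteq> v (Suc i)" if "Suc (Suc i) < n" for i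
  proof
    assume "v i = v (Suc i)"
    then have "v i \<in> verts (Cs ! i)" "v i \<in> verts (Cs ! Suc (Suc i))" using v[of i] v[of "Suc i"] that by auto
    then show False using linked_cycles_disjoint[OF chain Cs, of i "Suc (Suc i)"] that len by auto
  qed
  have coords: "\<exists>g. cycle_coords h g (Cs ! i)" if "i < n" for i
    using cycle_graph_coords[OF cycles_of_cycle_graph[OF chain cyc[OF that]]] size[OF cyc[OF that]] by metis
  \<comment> \<open>The first cycle carries its link at index 1 and the last one at index 0; the
    other marked vertex is an arbitrary neighbour, which gives \<open>d = 1\<close> in both
    cases.\<close>
  have "\<exists>g d. cycle_coords h g (Cs ! i) \<and> 0 < d \<and> 2 * d \<le> h \<and> (i = 0 \<or> Suc i = n \<longrightarrow> d = 1) \<and>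
      (0 < i \<longrightarrow> g 0 = v (i - 1)) \<and> (Suc i < n \<longrightarrow> g d = v i)" if i: "i < n" for i
  proof -
    obtain g where g: "cycle_coords h g (Cs ! i)" using coords[OF i] by blast
    have h0: "0 < h" using h by simp
    consider "i = 0" "Suc i < n" | "0 < i" "Suc i = n" | "0 < i" "Suc i < n" using i n by linarith
    then show ?thesis
    proof cases
      case 1
      then obtain g' where "cycle_coords h g' (Cs ! i)" "g' 1 = v i"
        using cycle_coords_start[OF g h0, of "v i" 1] v by blast
      then show ?thesis using 1 h by (intro exI[of _ g'] exI[of _ 1]) simp
    next
      case 2
      then have "v (i - 1) \<in> verts (Cs ! i)" using v[of "i - 1"] by simp
      then obtain g' where "cycle_coords h g' (Cs ! i)" "g' 0 = v (i - 1)"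
        using cycle_coords_start[OF g h0, of "v (i - 1)" 0] by blast
      then show ?thesis using 2 h by (intro exI[of _ g'] exI[of _ 1]) simp
    next
      case 3
      then have "v (i - 1) \<in> verts (Cs ! i)" "v i \<in> verts (Cs ! i)" "v (i - 1) \<noteq> v i"
        using v[of "i - 1"] v[of i] v_neq[of "i - 1"] by simp_all
      then obtain g' d where "cycle_coords h g' (Cs ! i)" "g' 0 = v (i - 1)" "g' d = v i" "0 < d" "2 * d \<le> h"
        using cycle_coords_position[OF g h0] by blast
      then show ?thesis using 3 by (intro exI[of _ g'] exI[of _ d]) simp
    qed
  qed
  then obtain F d where F: "\<And>i. i < n \<Longrightarrow> cycle_coords h (F i) (Cs ! i)"
    and d: "\<And>i. i < n \<Longrightarrow> 0 < d i \<and> 2 * d i \<le> h \<and> (i = 0 \<or> Suc i = n \<longrightarrow> d i = 1)"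
    and F0: "\<And>i. Suc i < n \<Longrightarrow> F (Suc i) 0 = v i" and Fd: "\<And>i. Suc i < n \<Longrightarrow> F i (d i) = v i"
    by (metis (no_types, lifting) Suc_lessD diff_Suc_1 zero_less_Suc)
  have F_verts: "verts (Cs ! i) = range (F i)" if "i < n" for i using F[OF that] by (simp add: cycle_coords_def)
  have d_less: "d i mod h = d i" if "i < n" for i using d[OF that] h by simp
  have F_Suc: "F i j = F (Suc i) j' \<longleftrightarrow> j mod h = d i \<and> j' mod h = 0" if i: "Suc i < n" for i j j'
  proof -
    have "F i j = F (Suc i) j' \<longleftrightarrow> F i j = v i \<and> F (Suc i) j' = v i"
      using shared[OF i, of "F i j"] F_verts[of i] F_verts[of "Suc i"] i by (metis Suc_lessD rangeI)
    also have "\<dots> \<longleftrightarrow> j mod h = d i mod h \<and> j' mod h = 0 mod h"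
      using cycle_coords_eq_iff[OF F, of i j "d i"] cycle_coords_eq_iff[OF F, of "Suc i" j' 0] F0[OF i] Fd[OF i] i
      by simp
    finally show ?thesis using d_less[of i] i by simp
  qed
  have F_far: "F i j \<noteq> F i' j'" if "Suc i < i'" "i' < n" for i i' j j'
  proof
    assume eq: "F i j = F i' j'"
    have "F i j \<in> verts (Cs ! i)" using F_verts[of i] that by simp
    moreover have "F i j \<in> verts (Cs ! i')" unfolding eq using F_verts[of i'] that by simp
    ultimately have "F i j \<in> verts (Cs ! i) \<inter> verts (Cs ! i')" by blast
    then show False using linked_cycles_disjoint[OF chain Cs, of i i'] that len by simp
  qed
  have F_eq: "F i j = F i' j' \<longleftrightarrow> i = i' \<and> j mod h = j' mod h \<or>
        i' = Suc i \<and> j mod h = d i \<and> j' mod h = 0 \<or>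
        i = Suc i' \<and> j' mod h = d i' \<and> j mod h = 0" if "i < n" "i' < n" for i i' j j'
  proof -
    consider "i = i'" | "i' = Suc i" | "i = Suc i'" | "Suc i < i'" | "Suc i' < i" by linarith
    then show ?thesis
    proof cases
      case 1
      then show ?thesis using cycle_coords_eq_iff[OF F] that by simp
    next
      case 2
      then show ?thesis using F_Suc[of i j j'] that by simp
    next
      case 3
      then show ?thesis using F_Suc[of i' j' j] that by auto
    next
      case 4
      then show ?thesis using F_far[of i i' j j'] that by simp
    next
      case 5
      then show ?thesis using F_far[of i' i j' j] that by auto
    qed
  qed
  have arcs_F: "arcs_ends (Cs ! i) = {(F i j, F i (Suc j)) | j. True} \<union> {(F i (Suc j), F i j) | j. True}"
    if "i < n" for i using F[OF that] by (simp add: cycle_coords_def)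
  have in_Cs: "\<exists>i<n. C = Cs ! i" if "C \<in> cycles_of G" for C
    using that len unfolding set_Cs[symmetric] in_set_conv_nth by blast
  have "arcs_ends G = (\<Union>i<n. arcs_ends (Cs ! i))"
  proof (intro equalityI subsetI)
    fix e assume "e \<in> arcs_ends G"
    then obtain x y where e: "e = (x, y)" "(x, y) \<in> arcs_ends G" by (cases e) auto
    obtain C where C: "C \<in> cycles_of G" "(x, y) \<in> arcs_ends C" using adjacent_in_cycle[OF chain e(2)] by metis
    obtain i where "i < n" "C = Cs ! i" using in_Cs[OF C(1)] by blast
    then show "e \<in> (\<Union>i<n. arcs_ends (Cs ! i))" using C e by blast
  next
    fix e assume "e \<in> (\<Union>i<n. arcs_ends (Cs ! i))"
    then obtain i where "i < n" "e \<in> arcs_ends (Cs ! i)" by blast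
    then show "e \<in> arcs_ends G" using arcs_ends_mono[OF cycles_of_subgraph[OF chain cyc]] by blast
  qed
  then have E: "arcs_ends G = {(F i j, F i (Suc j)) | i j. i < n} \<union> {(F i (Suc j), F i j) | i j. i < n}"
    using arcs_F by auto
  have "verts G = (\<Union>i<n. verts (Cs ! i))"
  proof (intro equalityI subsetI)
    fix x assume x: "x \<in> verts G"
    have sub: "verts (Cs ! 0) \<subseteq> verts G" using cycles_of_subgraph[OF chain cyc[of 0]] n by auto
    \<comment> \<open>Reaching a second vertex \<open>y\<close> forces an arc out of
      \<open>x\<close>, and every arc lies on a cycle; so no vertex is missed.\<close>
    obtain y where y: "y \<in> verts (Cs ! 0)" "y \<noteq> x" using cycle_has_adjacent[OF chain cyc[of 0]] n
      by (metis zero_less_numeral less_le_trans)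
    have "x \<rightarrow>\<^sup>*\<^bsub>G\<^esub> y" using reachable_in_chain[OF chain x] sub y by blast
    then obtain z where "x \<rightarrow>\<^bsub>G\<^esub> z" using y(2) by (cases rule: converse_reachable_cases) auto
    then obtain C where C: "C \<in> cycles_of G" "x \<in> verts C" using adjacent_in_cycle[OF chain] by metis
    then show "x \<in> (\<Union>i<n. verts (Cs ! i))" using in_Cs[OF C(1)] by blast
  next
    fix x assume "x \<in> (\<Union>i<n. verts (Cs ! i))"
    then obtain i where "i < n" "x \<in> verts (Cs ! i)" by blast
    then show "x \<in> verts G" using cycles_of_subgraph[OF chain cyc] by (auto simp: subgraph_def)
  qed
  then have V: "verts G = {F i j | i j. i < n}" using F_verts by auto
  have "0 < d i \<and> d i < h" if "i < n" for i using d[OF that] by auto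
  then have "chain_coords h n d F G"
    unfolding chain_coords_def using V E F_eq by simp
  moreover have "d i = k"
    if i: "0 < i" "Suc i < n" and pos: "\<And>C. internal_cycle G C \<Longrightarrow> in_position G C k" for i k
  proof -
    have "internal_cycle G (Cs ! i)"
      unfolding internal_cycle_def using linked_cycles_chain_order[OF chain Cs set_Cs] i len by blast
    moreover have "{w \<in> verts (Cs ! i). cut_vertex G w} = {F i 0, F i (d i)}"
    proof -
      have ends: "F i 0 = v (i - 1)" "F i (d i) = v i" using F0[of "i - 1"] Fd i by simp_all
      have a: "v (i - 1) \<in> verts (Cs ! i)" "cut_vertex G (v (i - 1))" using v[of "i - 1"] i by simp_all
      have b: "v i \<in> verts (Cs ! i)" "cut_vertex G (v i)" using v[of i] i by simp_all
      have "v (i - 1) \<noteq> v i" using v_neq[of "i - 1"] i by simp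
      then have "w = v (i - 1) \<or> w = v i" if "w \<in> verts (Cs ! i)" "cut_vertex G w" for w
        using no_three_cut_vertices_on_cycle[OF chain cyc, of i "v (i - 1)" "v i" w] a b that i by simp
      then show ?thesis unfolding ends using a b by blast
    qed
    moreover have "i < n" using i by simp
    ultimately show ?thesis
      using in_position_unique[OF F[of i] wf[of i], of "d i" G k] d[of i] pos[of "Cs ! i"] by simp
  qed
  ultimately show ?thesis using that[of d F] d[of 0] d[of "n - 1"] d n by auto
qed

section \<open>Isomorphism from equal coordinates\<close>

lemma digraph_isoI_verts:
  assumes G: "nomulti_digraph G" and G': "nomulti_digraph G'" and inj: "inj_on \<phi> (verts G)"
    and V: "\<phi> ` verts G = verts G'" and E: "map_prod \<phi> \<phi> ` arcs_ends G = arcs_ends G'"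
  shows "digraph_iso G G'"
proof -
  interpret G: nomulti_digraph G by (rule G)
  interpret G': nomulti_digraph G' by (rule G')
  \<comment> \<open>Without parallel arcs an arc is determined by its ends, so the vertex map
    dictates the arc map.\<close>
  define \<psi> where "\<psi> a = the_inv_into (arcs G') (arc_to_ends G') (map_prod \<phi> \<phi> (arc_to_ends G a))" for a
  \<comment> \<open>Taking over \<open>head G'\<close> and \<open>tail G'\<close> makes
    \<open>app_iso f G\<close> equal to \<open>G'\<close> as a record, also at values that are not
    arcs.\<close>
  define f where "f = \<lparr> iso_verts = \<phi>, iso_arcs = \<psi>, iso_head = head G', iso_tail = tail G' \<rparr>"
  have \<psi>: "\<psi> a \<in> arcs G'" "arc_to_ends G' (\<psi> a) = map_prod \<phi> \<phi> (arc_to_ends G a)" if "a \<in> arcs G" for a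
  proof -
    have "map_prod \<phi> \<phi> (arc_to_ends G a) \<in> arc_to_ends G' ` arcs G'"
      using E that unfolding arcs_ends_def by blast
    then show "\<psi> a \<in> arcs G'" "arc_to_ends G' (\<psi> a) = map_prod \<phi> \<phi> (arc_to_ends G a)"
      unfolding \<psi>_def using G'.inj_on_arc_to_ends
      by (auto intro: the_inv_into_into f_the_inv_into_f)
  qed
  have "inj_on \<psi> (arcs G)"
  proof (rule inj_onI)
    fix a b assume ab: "a \<in> arcs G" "b \<in> arcs G" "\<psi> a = \<psi> b"
    then have "map_prod \<phi> \<phi> (arc_to_ends G a) = map_prod \<phi> \<phi> (arc_to_ends G b)" using \<psi> by metis
    then have "arc_to_ends G a = arc_to_ends G b"
      using inj ab by (auto simp: arc_to_ends_def inj_on_def)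
    then show "a = b" using G.no_multi_arcs ab by blast
  qed
  moreover have "\<psi> ` arcs G = arcs G'"
  proof (intro equalityI subsetI)
    fix a' assume a': "a' \<in> arcs G'"
    then have "arc_to_ends G' a' \<in> map_prod \<phi> \<phi> ` (arc_to_ends G ` arcs G)"
      unfolding arcs_ends_def[of G, symmetric] E by (simp add: arcs_ends_def)
    then obtain a where a: "a \<in> arcs G" "arc_to_ends G' a' = map_prod \<phi> \<phi> (arc_to_ends G a)"
      unfolding image_image by blast
    then have "\<psi> a = a'" using \<psi> a' G'.no_multi_arcs by metis
    then show "a' \<in> \<psi> ` arcs G" using a by blast
  qed (use \<psi> in blast)
  ultimately have "G.digraph_isomorphism f" "G' = app_iso f G"
    using \<psi>(2) inj V G.wf_digraph_axioms
    by (auto simp: G.digraph_isomorphism_def f_def app_iso_def arc_to_ends_def)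
  then show ?thesis by (auto simp: digraph_iso_def)
qed

text \<open>All coincidences among the \<open>F i j\<close> and all adjacencies are determined by
  \<open>h\<close>, \<open>n\<close> and \<open>d\<close>, so sending \<open>F i j\<close> to
  \<open>F' i j\<close> is well defined and injective. A choice is made because a vertex has many
  coordinates.\<close>

lemma chain_coords_digraph_iso:
  assumes G: "nomulti_digraph G" "chain_coords h n d F G"
    and G': "nomulti_digraph G'" "chain_coords h n d' F' G'"
    and d: "\<And>i. i < n \<Longrightarrow> d i = d' i"
  shows "digraph_iso G G'"
proof -
  define \<phi> where "\<phi> x = (SOME y. \<exists>i j. i < n \<and> x = F i j \<and> y = F' i j)" for x
  have iff: "F i j = F i' j' \<longleftrightarrow> F' i j = F' i' j'" if "i < n" "i' < n" for i i' j j'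
    using chain_coords_eq_iff[OF G(2) that] chain_coords_eq_iff[OF G'(2) that] d that by auto
  have \<phi>: "\<phi> (F i j) = F' i j" if "i < n" for i j
    unfolding \<phi>_def using iff that by (intro some_equality) metis+
  have V: "verts G = {F i j | i j. i < n}" "verts G' = {F' i j | i j. i < n}"
    and E: "arcs_ends G = {(F i j, F i (Suc j)) | i j. i < n} \<union> {(F i (Suc j), F i j) | i j. i < n}"
      "arcs_ends G' = {(F' i j, F' i (Suc j)) | i j. i < n} \<union> {(F' i (Suc j), F' i j) | i j. i < n}"
    using G(2) G'(2) by (simp_all only: chain_coords_def)
  show ?thesis
  proof (rule digraph_isoI_verts[OF G(1) G'(1)])
    show "inj_on \<phi> (verts G)" unfolding V by (auto simp: inj_on_def \<phi> iff)
    show "\<phi> ` verts G = verts G'" unfolding V by (force simp: \<phi>)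
    have "map_prod \<phi> \<phi> ` {(F i j, F i (Suc j)) | i j. i < n} = {(F' i j, F' i (Suc j)) | i j. i < n}"
      "map_prod \<phi> \<phi> ` {(F i (Suc j), F i j) | i j. i < n} = {(F' i (Suc j), F' i j) | i j. i < n}"
      by (force simp: \<phi>)+
    then show "map_prod \<phi> \<phi> ` arcs_ends G = arcs_ends G'" unfolding E image_Un by simp
  qed
qed

lemma chain_h_cactus_nomulti: "chain_h_cactus h n G \<Longrightarrow> nomulti_digraph G"
  by (simp add: chain_h_cactus_def chain_cactus_def cactus_def graph_def digraph_def)

theorem theorem12:
  fixes h n :: nat
    and O\<^sub>n :: "('a,'b) pre_digraph"
    and M\<^sub>n :: "('c,'d) pre_digraph"
    and A\<^sub>n :: "('e,'f) pre_digraph"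
  assumes "h \<ge> 3" and "n \<ge> 3"
    and "ortho_chain h n O\<^sub>n"
    and "meta_chain h n M\<^sub>n"
    and "chain_h_cactus h n A\<^sub>n"
    and "\<not> digraph_iso A\<^sub>n O\<^sub>n"
    and "\<not> digraph_iso A\<^sub>n M\<^sub>n"
  shows "\<Psi> O\<^sub>n < \<Psi> A\<^sub>n \<and> \<Psi> A\<^sub>n < \<Psi> M\<^sub>n"
proof -
  have n: "2 \<le> n" "0 < n" using assms(2) by simp_all
  have O: "chain_h_cactus h n O\<^sub>n" "\<And>C. internal_cycle O\<^sub>n C \<Longrightarrow> in_position O\<^sub>n C 1"
    using assms(3) by (auto simp: ortho_chain_def)
  have M: "chain_h_cactus h n M\<^sub>n" "\<And>C. internal_cycle M\<^sub>n C \<Longrightarrow> in_position M\<^sub>n C 2"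
    using assms(4) by (auto simp: meta_chain_def)
  obtain a A where A: "chain_coords h n a A A\<^sub>n" "a 0 = 1" "a (n - 1) = 1" "\<And>i. i < n \<Longrightarrow> 2 * a i \<le> h"
    using chain_h_cactus_coords[OF assms(5) n(1) assms(1)] by metis
  obtain b B where B: "chain_coords h n b B O\<^sub>n" "b 0 = 1" "b (n - 1) = 1"
    and b: "\<And>i. 0 < i \<Longrightarrow> Suc i < n \<Longrightarrow> b i = 1"
    using chain_h_cactus_coords[OF O(1) n(1) assms(1)] O(2) by metis
  obtain c C where C: "chain_coords h n c C M\<^sub>n" "c 0 = 1" "c (n - 1) = 1" "\<And>i. i < n \<Longrightarrow> 2 * c i \<le> h"
    and c: "\<And>i. 0 < i \<Longrightarrow> Suc i < n \<Longrightarrow> c i = 2"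
    using chain_h_cactus_coords[OF M(1) n(1) assms(1)] M(2) by metis
  note pos = chain_coords_position[OF A(1)] chain_coords_position[OF B(1)] chain_coords_position[OF C(1)]
  have ends: "i = 0 \<or> i = n - 1 \<or> 0 < i \<and> Suc i < n" if "i < n" for i using that by linarith
  \<comment> \<open>The case \<open>h = 3\<close> drops out here: cycle 1 of the meta-chain is
    internal with distance 2, and twice a distance is at most \<open>h\<close>.\<close>
  have h: "4 \<le> h" using C(4)[of 1] c[of 1] assms(2) by simp
  \<comment> \<open>If all internal distances were 1, the convention at the ends would make
    \<open>a\<close> and \<open>b\<close> agree everywhere and the graphs isomorphic.\<close>
  have "\<exists>i. 0 < i \<and> Suc i < n \<and> a i \<noteq> 1"
  proof (rule ccontr)
    assume "\<not> ?thesis"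
    then have "a i = b i" if "i < n" for i using ends[OF that] A B b by auto
    then have "digraph_iso A\<^sub>n O\<^sub>n"
      by (rule chain_coords_digraph_iso[OF chain_h_cactus_nomulti[OF assms(5)] A(1)
          chain_h_cactus_nomulti[OF O(1)] B(1)])
    with assms(6) show False ..
  qed
  then obtain i where i: "0 < i" "Suc i < n" "a i \<noteq> 1" by blast
  have "\<exists>j. 0 < j \<and> Suc j < n \<and> a j \<noteq> 2"
  proof (rule ccontr)
    assume "\<not> ?thesis"
    then have "a i = c i" if "i < n" for i using ends[OF that] A C c by auto
    then have "digraph_iso A\<^sub>n M\<^sub>n"
      by (rule chain_coords_digraph_iso[OF chain_h_cactus_nomulti[OF assms(5)] A(1)
          chain_h_cactus_nomulti[OF M(1)] C(1)])
    with assms(7) show False ..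
  qed
  then obtain j where j: "0 < j" "Suc j < n" "a j \<noteq> 2" by blast
  have ortho: "fib (a i) * fib (h - a i) < fib 1 * fib (h - 1)" if "i < n" "a i \<noteq> 1" for i
    using that pos(1)[OF that(1)] A(4)[OF that(1)] by (intro fib_mult_less_ortho) auto
  have meta: "fib 2 * fib (h - 2) < fib (a i) * fib (h - a i)" if "i < n" "a i \<noteq> 2" for i
    using that pos(1)[OF that(1)] A(4)[OF that(1)] h by (intro fib_mult_greater_meta) auto
  \<comment> \<open>Larger products mean fewer sets, so the ortho-chain takes the part of
    \<open>d'\<close> in \<open>chain_count_mono\<close>.\<close>
  have "(\<Sum>t\<in>UNIV. chain_count h b n t) < (\<Sum>t\<in>UNIV. chain_count h a n t)"
  proof (rule chain_count_mono[OF assms(1), where j = i])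
    show "fib (a k) * fib (h - a k) \<le> fib (b k) * fib (h - b k)" if "k < n" for k
      using ends[OF that] b[of k] B ortho[OF that] by (cases "a k = 1") auto
    show "fib (a i) * fib (h - a i) < fib (b i) * fib (h - b i)"
      using i b[of i] ortho[of i] by simp
  qed (use pos i in auto)
  \<comment> \<open>Now \<open>a\<close> takes the part of \<open>d'\<close>. In the end cycles
    \<open>a\<close> and \<open>c\<close> are both 1, so equality holds there although distance 2
    would give a smaller product.\<close>
  moreover have "(\<Sum>t\<in>UNIV. chain_count h a n t) < (\<Sum>t\<in>UNIV. chain_count h c n t)"
  proof (rule chain_count_mono[OF assms(1), where j = j])
    show "fib (c k) * fib (h - c k) \<le> fib (a k) * fib (h - a k)" if "k < n" for k
      using ends[OF that] c[of k] A C meta[OF that] by (cases "a k = 2") auto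
    show "fib (c j) * fib (h - c j) < fib (a j) * fib (h - a j)"
      using j c[of j] meta[of j] by simp
  qed (use pos j in auto)
  ultimately show ?thesis
    using num_independent_sets_chain[OF A(1) n(2)] num_independent_sets_chain[OF B(1) n(2)]
      num_independent_sets_chain[OF C(1) n(2)] by simp
qed

end
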